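(* Let $(\Omega,\Sigma,\mu)$ be a measure space, let $\mathbb{X}$ be a quasi-Banach space endowed with a continuous quasi-norm $\|\cdot\|$, and let $\mathcal{F}\subseteq\Sigma$ be a nonempty family directed to $\Omega$. Then the sets $V_{E,\delta,t}\cap L(\mu,\mathcal{F},\mathbb{X})$, where $E\in\mathcal{F}$ and $\delta,t\in(0,\infty)$, form a neighbourhood basis at the origin for a vector topology on the vector space $L(\mu,\mathcal{F},\mathbb{X})$, and the resulting topological vector space $L_0(\mu,\mathcal{F},\mathbb{X})$ is complete.
   Context: Scalars are real or complex, and vector topologies are assumed to be Hausdorff. A topological vector space is complete if every Cauchy net converges. A quasi-norm on a vector space is a map $\|\cdot\|$ into $[0,\infty)$ with $\|x\|>0$ for $x\ne0$, $\|\lambda x\|=|\lambda|\|x\|$, and $\|x+y\|\le\kappa(\|x\|+\|y\|)$ for some constant $\kappa$; it induces a vector topology with neighbourhood basis of the origin $\{x\colon\|x\|\le\varepsilon\}$, $\varepsilon>0$. A quasi-Banach space is a complete quasi-normed space; here the quasi-norm is assumed continuous for the topology it induces, and $\mathbb{X}$ carries its Borel $\sigma$-algebra. A function $f\colon\Omega\to\mathbb{X}$ is strongly measurable if it is measurable and there is a separable subspace $\mathbb{Y}$ of $\mathbb{X}$ with $f(\omega)\in\mathbb{Y}$ for $\mu$-a.e. $\omega$. $L(\mu,\mathbb{X})$ is the vector space of all strongly measurable functions $\Omega\to\mathbb{X}$, modulo equality $\mu$-a.e. For $f\in L(\mu,\mathbb{X})$ and $t>0$ put $\Omega_{f,t}=\{\omega\in\Omega\colon\|f(\omega)\|>t\}$.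 For $E\in\Sigma$ and $\delta,t>0$ put $V_{E,\delta,t}=\{f\in L(\mu,\mathbb{X})\colon\mu(E\cap\Omega_{f,t})<\delta\}$. Put $L(\mu,E,\mathbb{X})=\{f\in L(\mu,\mathbb{X})\colon\mu(E\cap\Omega_{f,t})<\infty\text{ for some }t>0\}$ and $L(\mu,\mathcal{F},\mathbb{X})=\bigcap_{E\in\mathcal{F}}L(\mu,E,\mathbb{X})$. A family $\mathcal{F}\subseteq\Sigma$ is directed to $\Omega_0\in\Sigma$ if: for all $A,B\in\mathcal{F}$ there is $D\in\mathcal{F}$ with $A\cup B\subseteq D$; $\mu(A\setminus\Omega_0)=0$ for all $A\in\mathcal{F}$; and there is a countable family $\mathcal{G}\subseteq\mathcal{F}$ with $\mu(\Omega_0\setminus\bigcup_{A\in\mathcal{G}}A)=0$. *)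

theory Defs
  imports "HOL-Analysis.Analysis"
begin

(* The scalar type ranges over the class real_normed_field. Its norm is multiplicative, so by the
   Gelfand-Mazur theorem its members are exactly the real and the complex numbers with their usual
   absolute value, up to isometric isomorphism. *)

section \<open>Topological vector spaces\<close>

(* The library has vector spaces over a whole type only. The spaces of measurable functions below
   consist of equivalence classes and depend on parameters, so they need an explicit carrier. *)
locale vector_space_on =
  fixes V :: "'v set"
    and add :: "'v \<Rightarrow> 'v \<Rightarrow> 'v"
    and zero :: "'v"
    and smul :: "'k::field \<Rightarrow> 'v \<Rightarrow> 'v"
  assumes zero_closed: "zero \<in> V"
    and add_closed: "x \<in> V \<Longrightarrow> y \<in> V \<Longrightarrow> add x y \<in> V"
    and scale_closed: "x \<in> V \<Longrightarrow> smul a x \<in> V"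
    and add_assoc: "x \<in> V \<Longrightarrow> y \<in> V \<Longrightarrow> z \<in> V \<Longrightarrow> add (add x y) z = add x (add y z)"
    and add_comm: "x \<in> V \<Longrightarrow> y \<in> V \<Longrightarrow> add x y = add y x"
    and add_zero: "x \<in> V \<Longrightarrow> add x zero = x"
    and add_inverse: "x \<in> V \<Longrightarrow> add x (smul (-1) x) = zero"
    and scale_add_right: "x \<in> V \<Longrightarrow> y \<in> V \<Longrightarrow> smul a (add x y) = add (smul a x) (smul a y)"
    and scale_add_left: "x \<in> V \<Longrightarrow> smul (a + b) x = add (smul a x) (smul b x)"
    and scale_scale: "x \<in> V \<Longrightarrow> smul a (smul b x) = smul (a * b) x"
    and scale_one: "x \<in> V \<Longrightarrow> smul 1 x = x"

locale topological_vector_space_on = vector_space_on V add zero smul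
  for V :: "'v set"
    and add :: "'v \<Rightarrow> 'v \<Rightarrow> 'v"
    and zero :: "'v"
    and smul :: "'k::real_normed_field \<Rightarrow> 'v \<Rightarrow> 'v" +
  fixes T :: "'v topology"
  assumes topspace_eq: "topspace T = V"
    and Hausdorff: "Hausdorff_space T"
    and continuous_add: "continuous_map (prod_topology T T) T (\<lambda>(x, y). add x y)"
    and continuous_scale: "continuous_map (prod_topology euclidean T) T (\<lambda>(a, x). smul a x)"

definition nbhd_of :: "'v topology \<Rightarrow> 'v \<Rightarrow> 'v set \<Rightarrow> bool" where
  "nbhd_of T p U \<longleftrightarrow> U \<subseteq> topspace T \<and> (\<exists>W. openin T W \<and> p \<in> W \<and> W \<subseteq> U)"

definition nbhd_basis_at :: "'v topology \<Rightarrow> 'v \<Rightarrow> 'v set set \<Rightarrow> bool" where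
  "nbhd_basis_at T p B \<longleftrightarrow>
     (\<forall>U\<in>B. nbhd_of T p U) \<and> (\<forall>W. nbhd_of T p W \<longrightarrow> (\<exists>U\<in>B. U \<subseteq> W))"

section \<open>Nets and completeness\<close>

definition directed_set :: "'i set \<Rightarrow> ('i \<Rightarrow> 'i \<Rightarrow> bool) \<Rightarrow> bool" where
  "directed_set I le \<longleftrightarrow> I \<noteq> {} \<and> (\<forall>i\<in>I. le i i)
     \<and> (\<forall>i\<in>I. \<forall>j\<in>I. \<forall>k\<in>I. le i j \<longrightarrow> le j k \<longrightarrow> le i k)
     \<and> (\<forall>i\<in>I. \<forall>j\<in>I. \<exists>k\<in>I. le i k \<and> le j k)"

definition net_converges ::
    "'v topology \<Rightarrow> 'i set \<Rightarrow> ('i \<Rightarrow> 'i \<Rightarrow> bool) \<Rightarrow> ('i \<Rightarrow> 'v) \<Rightarrow> 'v \<Rightarrow> bool" where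
  "net_converges T I le x l \<longleftrightarrow> l \<in> topspace T
     \<and> (\<forall>U. nbhd_of T l U \<longrightarrow> (\<exists>i0\<in>I. \<forall>i\<in>I. le i0 i \<longrightarrow> x i \<in> U))"

definition cauchy_net ::
    "('v \<Rightarrow> 'v \<Rightarrow> 'v) \<Rightarrow> 'v \<Rightarrow> ('k::field \<Rightarrow> 'v \<Rightarrow> 'v) \<Rightarrow> 'v topology
      \<Rightarrow> 'i set \<Rightarrow> ('i \<Rightarrow> 'i \<Rightarrow> bool) \<Rightarrow> ('i \<Rightarrow> 'v) \<Rightarrow> bool" where
  "cauchy_net add zero smul T I le x \<longleftrightarrow>
     (\<forall>U. nbhd_of T zero U \<longrightarrow>
        (\<exists>i0\<in>I. \<forall>i\<in>I. \<forall>j\<in>I. le i0 i \<longrightarrow> le i0 j \<longrightarrow> add (x i) (smul (-1) (x j)) \<in> U))"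

(* HOL cannot quantify over the index type of a net inside a definition. The index type
   'v set * 'v is large enough to index by pairs of a tail and a point in it, and the lemma
   complete_tvs_net shows that convergence of Cauchy nets over every index type follows. *)
definition complete_tvs ::
    "('v \<Rightarrow> 'v \<Rightarrow> 'v) \<Rightarrow> 'v \<Rightarrow> ('k::field \<Rightarrow> 'v \<Rightarrow> 'v) \<Rightarrow> 'v topology \<Rightarrow> bool" where
  "complete_tvs add zero smul T \<longleftrightarrow>
     (\<forall>(I :: ('v set \<times> 'v) set) le x.
        directed_set I le \<longrightarrow> x ` I \<subseteq> topspace T \<longrightarrow> cauchy_net add zero smul T I le x \<longrightarrow>
        (\<exists>l. net_converges T I le x l))"

lemma complete_tvs_net:
  fixes I :: "'i set"
  assumes c: "complete_tvs add zero smul T"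
    and d: "directed_set I le" and x: "x ` I \<subseteq> topspace T"
    and C: "cauchy_net add zero smul T I le x"
  shows "\<exists>l. net_converges T I le x l"
proof -
  define tail where "tail i = x ` {j\<in>I. le i j}" for i
  define J where "J = {(A, a). a \<in> A \<and> (\<exists>i\<in>I. A = tail i)}"
  define le' where "le' p q \<longleftrightarrow> fst q \<subseteq> fst p" for p q :: "'a set \<times> 'a"
  have refl: "le i i" if "i \<in> I" for i using d that unfolding directed_set_def by blast
  have trans: "le i k" if "i \<in> I" "j \<in> I" "k \<in> I" "le i j" "le j k" for i j k
    using d that unfolding directed_set_def by blast
  have mem: "(tail i, x j) \<in> J" if "i \<in> I" "j \<in> I" "le i j" for i j
    using that by (auto simp: J_def tail_def)
  have "directed_set J le'"
    unfolding directed_set_def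
  proof (intro conjI ballI impI)
    obtain i where "i \<in> I" using d unfolding directed_set_def by blast
    then show "J \<noteq> {}" using mem[of i i] refl by blast
  next
    fix p q assume "p \<in> J" "q \<in> J"
    then obtain i j where ij: "i \<in> I" "fst p = tail i" "j \<in> I" "fst q = tail j"
      by (auto simp: J_def)
    then obtain k where k: "k \<in> I" "le i k" "le j k"
      using d unfolding directed_set_def by meson
    have "tail k \<subseteq> tail i" "tail k \<subseteq> tail j"
      using trans[OF ij(1) k(1) _ k(2)] trans[OF ij(3) k(1) _ k(3)] unfolding tail_def by blast+
    then have "le' p (tail k, x k) \<and> le' q (tail k, x k)"
      using ij by (simp add: le'_def)
    then show "\<exists>r\<in>J. le' p r \<and> le' q r"
      using mem[OF k(1) k(1) refl[OF k(1)]] by blast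
  qed (auto simp: le'_def)
  moreover have "snd ` J \<subseteq> topspace T" using x by (auto simp: J_def tail_def)
  moreover have "cauchy_net add zero smul T J le' snd"
    unfolding cauchy_net_def
  proof (intro allI impI)
    fix U assume "nbhd_of T zero U"
    then obtain i0 where i0: "i0 \<in> I"
      "\<And>i j. i \<in> I \<Longrightarrow> j \<in> I \<Longrightarrow> le i0 i \<Longrightarrow> le i0 j \<Longrightarrow> add (x i) (smul (-1) (x j)) \<in> U"
      using C unfolding cauchy_net_def by meson
    have "\<exists>i\<in>I. le i0 i \<and> snd p = x i" if "p \<in> J" "le' (tail i0, x i0) p" for p
    proof -
      have "snd p \<in> tail i0" using that by (auto simp: J_def le'_def)
      then show ?thesis by (auto simp: tail_def)
    qed
    then have "\<forall>p\<in>J. \<forall>q\<in>J. le' (tail i0, x i0) p \<longrightarrow> le' (tail i0, x i0) q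
        \<longrightarrow> add (snd p) (smul (-1) (snd q)) \<in> U"
      using i0(2) by metis
    then show "\<exists>i0\<in>J. \<forall>i\<in>J. \<forall>j\<in>J. le' i0 i \<longrightarrow> le' i0 j \<longrightarrow> add (snd i) (smul (-1) (snd j)) \<in> U"
      using mem[OF i0(1) i0(1) refl[OF i0(1)]] by blast
  qed
  ultimately obtain l where l: "net_converges T J le' snd l"
    using c unfolding complete_tvs_def by blast
  have "net_converges T I le x l"
    unfolding net_converges_def
  proof (intro conjI allI impI)
    show "l \<in> topspace T" using l by (simp add: net_converges_def)
  next
    fix U assume "nbhd_of T l U"
    then obtain p where p: "p \<in> J" "\<And>q. q \<in> J \<Longrightarrow> le' p q \<Longrightarrow> snd q \<in> U"
      using l unfolding net_converges_def by meson
    then obtain i where i: "i \<in> I" "fst p = tail i" by (auto simp: J_def)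
    have "x j \<in> U" if "j \<in> I" "le i j" for j
      using p(2)[OF mem[OF i(1) that]] i(2) by (simp add: le'_def)
    then show "\<exists>i0\<in>I. \<forall>i\<in>I. le i0 i \<longrightarrow> x i \<in> U" using i(1) by blast
  qed
  then show ?thesis ..
qed

section \<open>Quasi-Banach spaces\<close>

locale quasi_normed_space = vector_space smul
  for smul :: "'k::real_normed_field \<Rightarrow> 'x::ab_group_add \<Rightarrow> 'x" +
  fixes qn :: "'x \<Rightarrow> real"
  assumes qn_nonneg: "0 \<le> qn x"
    and qn_pos: "x \<noteq> 0 \<Longrightarrow> 0 < qn x"
    and qn_scale: "qn (smul a x) = norm a * qn x"
    and qn_quasi_triangle: "\<exists>\<kappa>. \<forall>x y. qn (x + y) \<le> \<kappa> * (qn x + qn y)"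

definition qn_topology :: "('x::ab_group_add \<Rightarrow> real) \<Rightarrow> 'x topology" where
  "qn_topology qn = topology (\<lambda>U. \<forall>x\<in>U. \<exists>e>0. \<forall>y. qn (y - x) \<le> e \<longrightarrow> y \<in> U)"

lemma openin_qn_topology:
  "openin (qn_topology qn) U \<longleftrightarrow> (\<forall>x\<in>U. \<exists>e>0. \<forall>y. qn (y - x) \<le> e \<longrightarrow> y \<in> U)"
proof -
  have "istopology (\<lambda>U. \<forall>x\<in>U. \<exists>e>0. \<forall>y. qn (y - x) \<le> e \<longrightarrow> y \<in> U)"
    unfolding istopology_def
  proof (intro conjI allI impI ballI)
    fix S S' x
    assume S: "\<forall>x\<in>S. \<exists>e>0. \<forall>y. qn (y - x) \<le> e \<longrightarrow> y \<in> S"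
      and S': "\<forall>x\<in>S'. \<exists>e>0. \<forall>y. qn (y - x) \<le> e \<longrightarrow> y \<in> S'" and x: "x \<in> S \<inter> S'"
    obtain d where "d > 0" "\<forall>y. qn (y - x) \<le> d \<longrightarrow> y \<in> S" using S x by blast
    moreover obtain e where "e > 0" "\<forall>y. qn (y - x) \<le> e \<longrightarrow> y \<in> S'" using S' x by blast
    ultimately show "\<exists>e>0. \<forall>y. qn (y - x) \<le> e \<longrightarrow> y \<in> S \<inter> S'"
      by (intro exI[of _ "min d e"]) simp
  next
    fix K x
    assume K: "\<forall>S\<in>K. \<forall>x\<in>S. \<exists>e>0. \<forall>y. qn (y - x) \<le> e \<longrightarrow> y \<in> S" and "x \<in> \<Union>K"
    then obtain S where S: "S \<in> K" "x \<in> S" by blast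
    then obtain e where "e > 0" "\<forall>y. qn (y - x) \<le> e \<longrightarrow> y \<in> S" using K by blast
    then show "\<exists>e>0. \<forall>y. qn (y - x) \<le> e \<longrightarrow> y \<in> \<Union>K" using S(1) by blast
  qed
  then show ?thesis by (simp add: qn_topology_def topology_inverse')
qed

lemma topspace_qn_topology [simp]: "topspace (qn_topology qn) = UNIV"
proof -
  have "openin (qn_topology qn) UNIV"
    unfolding openin_qn_topology using zero_less_one by blast
  then show ?thesis using openin_subset by blast
qed

lemma (in quasi_normed_space) nbhd_basis_qn_topology:
  "nbhd_basis_at (qn_topology qn) 0 {{x. qn x \<le> e} | e. 0 < e}"
proof -
  obtain k0 where k0: "\<And>x y. qn (x + y) \<le> k0 * (qn x + qn y)" using qn_quasi_triangle by blast
  define k where "k = max 1 k0"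
  have k: "qn (x + y) \<le> k * (qn x + qn y)" "k > 0" for x y
  proof -
    have "k0 * (qn x + qn y) \<le> k * (qn x + qn y)"
      by (rule mult_right_mono) (auto simp: k_def qn_nonneg)
    then show "qn (x + y) \<le> k * (qn x + qn y)" using k0[of x y] by linarith
  qed (simp add: k_def)
  have qn0: "qn 0 = 0" using qn_scale[of 0 0] by simp
  have "nbhd_of (qn_topology qn) 0 {x. qn x \<le> e}" if "e > 0" for e
  proof -
    define W where "W = {x. \<exists>d>0. \<forall>y. qn (y - x) \<le> d \<longrightarrow> qn y \<le> e}"
    have "openin (qn_topology qn) W"
      unfolding openin_qn_topology
    proof
      fix x assume "x \<in> W"
      then obtain d where d: "d > 0" "\<And>y. qn (y - x) \<le> d \<Longrightarrow> qn y \<le> e"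
        unfolding W_def by blast
      define d' where "d' = d / (2 * k)"
      have d': "d' > 0" "k * (d' + d') = d" using d(1) k(2) by (simp_all add: d'_def)
      have "qn z \<le> e" if "qn (y - x) \<le> d'" "qn (z - y) \<le> d'" for y z
      proof -
        have "qn (z - x) \<le> k * (qn (z - y) + qn (y - x))" using k(1)[of "z - y" "y - x"] by simp
        also have "\<dots> \<le> k * (d' + d')" using that k(2) by (intro mult_left_mono) auto
        finally show ?thesis using d(2)[of z] d'(2) by linarith
      qed
      then show "\<exists>e>0. \<forall>y. qn (y - x) \<le> e \<longrightarrow> y \<in> W" using d'(1) unfolding W_def by blast
    qed
    moreover have "0 \<in> W" unfolding W_def mem_Collect_eq by (rule exI[of _ e]) (simp add: that)
    moreover have "W \<subseteq> {x. qn x \<le> e}"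
    proof
      fix x assume "x \<in> W"
      then obtain d where d: "d > 0" "\<forall>y. qn (y - x) \<le> d \<longrightarrow> qn y \<le> e" unfolding W_def by blast
      have "qn (x - x) \<le> d" using qn0 d(1) by simp
      then show "x \<in> {x. qn x \<le> e}" using d(2) by blast
    qed
    ultimately show ?thesis unfolding nbhd_of_def topspace_qn_topology by blast
  qed
  then have "\<forall>U\<in>{{x. qn x \<le> e} | e. 0 < e}. nbhd_of (qn_topology qn) 0 U" by fast
  moreover have "\<exists>U\<in>{{x. qn x \<le> e} | e. 0 < e}. U \<subseteq> W" if W: "nbhd_of (qn_topology qn) 0 W" for W
  proof -
    obtain U where U: "openin (qn_topology qn) U" "0 \<in> U" "U \<subseteq> W"
      using W unfolding nbhd_of_def by blast
    then obtain e where e: "e > 0" "\<forall>y. qn (y - 0) \<le> e \<longrightarrow> y \<in> U"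
      unfolding openin_qn_topology by blast
    have "{x. qn x \<le> e} \<subseteq> W" using e(2) U(3) by auto
    then show ?thesis using e(1) by blast
  qed
  ultimately show ?thesis unfolding nbhd_basis_at_def by simp
qed

locale quasi_banach_space = quasi_normed_space smul qn
  for smul :: "'k::real_normed_field \<Rightarrow> 'x::ab_group_add \<Rightarrow> 'x" and qn :: "'x \<Rightarrow> real" +
  assumes complete: "complete_tvs (+) 0 smul (qn_topology qn)"

definition qn_borel :: "('x::ab_group_add \<Rightarrow> real) \<Rightarrow> 'x measure" where
  "qn_borel qn = sigma UNIV {U. openin (qn_topology qn) U}"

section \<open>Spaces of strongly measurable functions\<close>

definition strongly_measurable ::
    "'a measure \<Rightarrow> ('k::real_normed_field \<Rightarrow> 'x::ab_group_add \<Rightarrow> 'x) \<Rightarrow> ('x \<Rightarrow> real)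
      \<Rightarrow> ('a \<Rightarrow> 'x) set" where
  "strongly_measurable M smul qn =
     {f \<in> measurable M (qn_borel qn).
        \<exists>Y. module.subspace smul Y \<and> separable_space (subtopology (qn_topology qn) Y)
          \<and> (AE \<omega> in M. f \<omega> \<in> Y)}"

definition L_space ::
    "'a measure \<Rightarrow> ('k::real_normed_field \<Rightarrow> 'x::ab_group_add \<Rightarrow> 'x) \<Rightarrow> ('x \<Rightarrow> real)
      \<Rightarrow> ('a \<Rightarrow> 'x) set set" where
  "L_space M smul qn =
     strongly_measurable M smul qn //
       {(f, g). f \<in> strongly_measurable M smul qn \<and> g \<in> strongly_measurable M smul qn
          \<and> (AE \<omega> in M. f \<omega> = g \<omega>)}"

(* The operations of L_space. Since M need not be complete and functions are only almost everywhere
   separably valued, a pointwise sum of representatives may fail to be measurable on a null set. The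
   sum of two classes therefore consists of the strongly measurable functions that agree almost
   everywhere with such a pointwise sum. *)
definition L_add ::
    "'a measure \<Rightarrow> ('k::real_normed_field \<Rightarrow> 'x::ab_group_add \<Rightarrow> 'x) \<Rightarrow> ('x \<Rightarrow> real)
      \<Rightarrow> ('a \<Rightarrow> 'x) set \<Rightarrow> ('a \<Rightarrow> 'x) set \<Rightarrow> ('a \<Rightarrow> 'x) set" where
  "L_add M smul qn A B =
     {h \<in> strongly_measurable M smul qn. \<exists>f\<in>A. \<exists>g\<in>B. AE \<omega> in M. h \<omega> = f \<omega> + g \<omega>}"

definition L_scale ::
    "'a measure \<Rightarrow> ('k::real_normed_field \<Rightarrow> 'x::ab_group_add \<Rightarrow> 'x) \<Rightarrow> ('x \<Rightarrow> real)
      \<Rightarrow> 'k \<Rightarrow> ('a \<Rightarrow> 'x) set \<Rightarrow> ('a \<Rightarrow> 'x) set" where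
  "L_scale M smul qn c A =
     {h \<in> strongly_measurable M smul qn. \<exists>f\<in>A. AE \<omega> in M. h \<omega> = smul c (f \<omega>)}"

definition L_zero ::
    "'a measure \<Rightarrow> ('k::real_normed_field \<Rightarrow> 'x::ab_group_add \<Rightarrow> 'x) \<Rightarrow> ('x \<Rightarrow> real)
      \<Rightarrow> ('a \<Rightarrow> 'x) set" where
  "L_zero M smul qn = {h \<in> strongly_measurable M smul qn. AE \<omega> in M. h \<omega> = 0}"

definition superlevel :: "'a measure \<Rightarrow> ('x \<Rightarrow> real) \<Rightarrow> ('a \<Rightarrow> 'x) \<Rightarrow> real \<Rightarrow> 'a set" where
  "superlevel M qn f t = {\<omega> \<in> space M. qn (f \<omega>) > t}"

(* Membership below does not depend on the chosen representative f of the class A. *)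
definition V_set ::
    "'a measure \<Rightarrow> ('k::real_normed_field \<Rightarrow> 'x::ab_group_add \<Rightarrow> 'x) \<Rightarrow> ('x \<Rightarrow> real)
      \<Rightarrow> 'a set \<Rightarrow> real \<Rightarrow> real \<Rightarrow> ('a \<Rightarrow> 'x) set set" where
  "V_set M smul qn E \<delta> t =
     {A \<in> L_space M smul qn. \<exists>f\<in>A. emeasure M (E \<inter> superlevel M qn f t) < ennreal \<delta>}"

definition L_on ::
    "'a measure \<Rightarrow> ('k::real_normed_field \<Rightarrow> 'x::ab_group_add \<Rightarrow> 'x) \<Rightarrow> ('x \<Rightarrow> real)
      \<Rightarrow> 'a set \<Rightarrow> ('a \<Rightarrow> 'x) set set" where
  "L_on M smul qn E =
     {A \<in> L_space M smul qn. \<exists>f\<in>A. \<exists>t>0. emeasure M (E \<inter> superlevel M qn f t) < \<infinity>}"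

definition L_family ::
    "'a measure \<Rightarrow> ('k::real_normed_field \<Rightarrow> 'x::ab_group_add \<Rightarrow> 'x) \<Rightarrow> ('x \<Rightarrow> real)
      \<Rightarrow> 'a set set \<Rightarrow> ('a \<Rightarrow> 'x) set set" where
  "L_family M smul qn F = (\<Inter>E\<in>F. L_on M smul qn E)"

definition directed_to :: "'a measure \<Rightarrow> 'a set set \<Rightarrow> 'a set \<Rightarrow> bool" where
  "directed_to M F \<Omega>0 \<longleftrightarrow>
     F \<subseteq> sets M \<and> \<Omega>0 \<in> sets M
     \<and> (\<forall>A\<in>F. \<forall>B\<in>F. \<exists>D\<in>F. A \<union> B \<subseteq> D)
     \<and> (\<forall>A\<in>F. emeasure M (A - \<Omega>0) = 0)
     \<and> (\<exists>G\<subseteq>F. countable G \<and> emeasure M (\<Omega>0 - \<Union>G) = 0)"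

end

(* Write |f > t|_E for the measure of E \<inter> {|f| > t}. The quasi-triangle inequality gives
   |f + g > K (s + t)|_E \<le> |f > s|_E + |g > t|_E, so the sets V satisfy the axioms of a
   neighbourhood base; they are absorbing because finiteness of one level set forces
   |f > t|_E \<rightarrow> 0 as t \<rightarrow> \<infinity>, and they separate points because countably many E cover the space.
   For completeness, choose D 0 \<subseteq> D 1 \<subseteq> ... covering the space and a sequence in the net that is
   Cauchy at a geometric rate on the D n; it converges almost everywhere to some h. For arbitrary E
   in the family, bound the distance of the net to h on E \<inter> D m and let m tend to infinity. *)
theory Submission
  imports Defs
begin

section \<open>Vector topologies from a neighbourhood base\<close>

text \<open>Two obstacles lie behind the technical choices. The measure need not be complete, and
  separable values are only known almost everywhere, so pointwise sums and limits of representatives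
  may fail to be measurable. They are formed after resetting the functions to 0 on a null set;
  separability then turns preimages under a sum into countable unions, while limits rest on the
  openness of balls, which comes from the continuity of the quasi-norm. The other obstacle is that
  every use of the quasi-triangle inequality costs a factor K = \<open>qconst\<close>, so a sum of n
  increments may cost the n-th power of K. The geometric rate is therefore taken as
  \<open>ratio\<close> = 1/(2K), for which the estimate of a tail reproduces itself and its constant
  stays independent of the number of terms. In the completeness proof the chosen sequence need not
  be cofinal in the net. A late net term and a sequence term are linked by an index above both. For
  fixed m the sequence index goes to infinity first, which removes all error terms of the
  sequence.\<close>

context vector_space_on
begin

definition vdiff :: "'v \<Rightarrow> 'v \<Rightarrow> 'v" where
  "vdiff x y = add x (smul (-1) y)"

lemma vdiff_closed: "x \<in> V \<Longrightarrow> y \<in> V \<Longrightarrow> vdiff x y \<in> V"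
  by (simp add: vdiff_def add_closed scale_closed)

lemma vdiff_self: "x \<in> V \<Longrightarrow> vdiff x x = zero"
  by (simp add: vdiff_def add_inverse)

lemma zero_scale: "x \<in> V \<Longrightarrow> smul 0 x = zero"
  using scale_add_left[of x 1 "-1"] by (simp add: scale_one add_inverse)

lemma zero_add: "x \<in> V \<Longrightarrow> add zero x = x"
  by (metis add_comm add_zero zero_closed)

lemma add_add_swap:
  assumes "x \<in> V" "y \<in> V" "u \<in> V" "v \<in> V"
  shows "add (add x y) (add u v) = add (add x u) (add y v)"
proof -
  have "add (add x y) (add u v) = add x (add (add y u) v)"
    using assms by (simp add: add_assoc add_closed)
  also have "\<dots> = add x (add (add u y) v)"
    using add_comm[OF assms(2,3)] by simp
  also have "\<dots> = add (add x u) (add y v)"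
    using assms by (simp add: add_assoc add_closed)
  finally show ?thesis .
qed

lemma vdiff_add_add:
  assumes "x \<in> V" "y \<in> V" "u \<in> V" "v \<in> V"
  shows "vdiff (add x y) (add u v) = add (vdiff x u) (vdiff y v)"
  using assms by (simp add: vdiff_def scale_add_right add_add_swap scale_closed)

lemma add_vdiff_cancel_left:
  assumes "x \<in> V" "y \<in> V"
  shows "add y (vdiff x y) = x"
proof -
  have "add y (vdiff x y) = add (add y (smul (-1) y)) x"
    using assms add_comm[OF assms(1) scale_closed[OF assms(2), of "-1"]]
    by (simp add: vdiff_def add_assoc scale_closed)
  then show ?thesis
    using assms by (simp add: add_inverse zero_add)
qed

lemma vdiff_vdiff_trans:
  assumes "x \<in> V" "y \<in> V" "z \<in> V"
  shows "add (vdiff x y) (vdiff y z) = vdiff x z"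
proof -
  let ?y = "smul (-1) y" and ?z = "smul (-1) z"
  have V: "?y \<in> V" "?z \<in> V" "add y ?z \<in> V" using assms by (simp_all add: scale_closed add_closed)
  have "add (vdiff x y) (vdiff y z) = add x (add ?y (add y ?z))"
    using assms V by (simp add: vdiff_def add_assoc)
  also have "add ?y (add y ?z) = add (add ?y y) ?z"
    using assms V by (simp add: add_assoc)
  also have "add ?y y = zero"
    using assms V by (simp add: add_comm[of ?y] add_inverse)
  finally show ?thesis
    using V by (simp add: zero_add vdiff_def)
qed

lemma scale_vdiff:
  assumes "x \<in> V" "y \<in> V"
  shows "smul a (vdiff x y) = vdiff (smul a x) (smul a y)"
  using assms by (simp add: vdiff_def scale_add_right scale_closed scale_scale)

lemma vdiff_scale_left:
  assumes "x \<in> V"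
  shows "vdiff (smul a x) (smul b x) = smul (a - b) x"
  using assms scale_add_left[of x a "-b"] by (simp add: vdiff_def scale_scale)

lemma minus_vdiff:
  assumes "x \<in> V" "y \<in> V"
  shows "smul (-1) (vdiff x y) = vdiff y x"
  using assms add_comm[OF scale_closed[OF assms(1), of "-1"] assms(2)]
  by (simp add: vdiff_def scale_add_right scale_closed scale_scale scale_one)

lemma vdiff_zero: "x \<in> V \<Longrightarrow> vdiff x zero = x"
  by (metis add_vdiff_cancel_left vdiff_closed zero_add zero_closed)

lemma vdiff_eq_zero:
  assumes "x \<in> V" "y \<in> V" "vdiff x y = zero"
  shows "x = y"
  using add_vdiff_cancel_left[OF assms(1,2)] assms by (simp add: add_zero)

end

text \<open>The bound c in \<open>base_scale\<close> is arbitrary, so that one axiom supplies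
  symmetry (c = 1) and also the uniformity over bounded sets of scalars that joint continuity of
  scaling requires. Members of \<open>B\<close> are not assumed open.\<close>

locale tvs_neighbourhood_base = vector_space_on V add zero smul
  for V :: "'v set"
    and add :: "'v \<Rightarrow> 'v \<Rightarrow> 'v"
    and zero :: "'v"
    and smul :: "'k::real_normed_field \<Rightarrow> 'v \<Rightarrow> 'v" +
  fixes B :: "'v set set"
  assumes base_nonempty: "B \<noteq> {}"
    and base_subset: "U \<in> B \<Longrightarrow> U \<subseteq> V"
    and base_inter: "U \<in> B \<Longrightarrow> U' \<in> B \<Longrightarrow> \<exists>W\<in>B. W \<subseteq> U \<inter> U'"
    and base_add: "U \<in> B \<Longrightarrow> \<exists>W\<in>B. \<forall>x\<in>W. \<forall>y\<in>W. add x y \<in> U"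
    and base_scale: "U \<in> B \<Longrightarrow> \<exists>W\<in>B. \<forall>x\<in>W. \<forall>a. norm a \<le> c \<longrightarrow> smul a x \<in> U"
    and base_absorbing: "U \<in> B \<Longrightarrow> x \<in> V \<Longrightarrow> \<exists>e>0. \<forall>a. norm a < e \<longrightarrow> smul a x \<in> U"
    and base_separating: "x \<in> V \<Longrightarrow> x \<noteq> zero \<Longrightarrow> \<exists>U\<in>B. x \<notin> U"
begin

definition base_open :: "'v set \<Rightarrow> bool" where
  "base_open S \<longleftrightarrow> S \<subseteq> V \<and> (\<forall>x\<in>S. \<exists>U\<in>B. \<forall>y\<in>V. vdiff y x \<in> U \<longrightarrow> y \<in> S)"

lemma base_openD:
  "base_open S \<Longrightarrow> x \<in> S \<Longrightarrow> \<exists>U\<in>B. \<forall>y\<in>V. vdiff y x \<in> U \<longrightarrow> y \<in> S"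
  by (simp add: base_open_def)

definition base_topology :: "'v topology" where
  "base_topology = topology base_open"

lemma openin_base_topology: "openin base_topology S \<longleftrightarrow> base_open S"
proof -
  have "istopology base_open"
    unfolding istopology_def
  proof (intro conjI allI impI)
    fix S S' assume S: "base_open S" "base_open S'"
    show "base_open (S \<inter> S')"
      unfolding base_open_def
    proof (intro conjI ballI)
      fix x assume "x \<in> S \<inter> S'"
      then have x: "x \<in> S" "x \<in> S'" by auto
      obtain U where U: "U \<in> B" "\<forall>y\<in>V. vdiff y x \<in> U \<longrightarrow> y \<in> S"
        using base_openD[OF S(1) x(1)] by (elim bexE)
      obtain U' where U': "U' \<in> B" "\<forall>y\<in>V. vdiff y x \<in> U' \<longrightarrow> y \<in> S'"
        using base_openD[OF S(2) x(2)] by (elim bexE)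
      obtain W where "W \<in> B" "W \<subseteq> U \<inter> U'"
        using base_inter[OF U(1) U'(1)] by (elim bexE)
      with U U' show "\<exists>U\<in>B. \<forall>y\<in>V. vdiff y x \<in> U \<longrightarrow> y \<in> S \<inter> S'" by blast
    qed (use S in \<open>auto simp: base_open_def\<close>)
  next
    fix K assume K: "\<forall>S\<in>K. base_open S"
    show "base_open (\<Union>K)"
      unfolding base_open_def
    proof (intro conjI ballI)
      fix x assume "x \<in> \<Union>K"
      then obtain S where S: "S \<in> K" "x \<in> S" by blast
      then obtain U where U: "U \<in> B" "\<forall>y\<in>V. vdiff y x \<in> U \<longrightarrow> y \<in> S"
        using base_openD K by meson
      with S show "\<exists>U\<in>B. \<forall>y\<in>V. vdiff y x \<in> U \<longrightarrow> y \<in> \<Union>K" by blast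
    qed (use K in \<open>auto simp: base_open_def\<close>)
  qed
  then show ?thesis by (simp add: base_topology_def topology_inverse')
qed

lemma topspace_base_topology: "topspace base_topology = V"
proof
  have "base_open V" using base_nonempty unfolding base_open_def by auto
  then show "V \<subseteq> topspace base_topology"
    using openin_subset openin_base_topology by blast
  show "topspace base_topology \<subseteq> V"
    using openin_topspace[of base_topology] openin_base_topology base_open_def by blast
qed

lemma zero_in_base:
  assumes "U \<in> B"
  shows "zero \<in> U"
proof -
  obtain e where "e > 0" "\<forall>a. norm a < e \<longrightarrow> smul a zero \<in> U"
    using base_absorbing[OF assms zero_closed] by blast
  then have "smul 0 zero \<in> U" by simp
  then show ?thesis by (simp add: zero_scale zero_closed)
qed

lemma base_minus: "U \<in> B \<Longrightarrow> \<exists>W\<in>B. \<forall>x\<in>W. smul (-1) x \<in> U"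
  using base_scale[of U 1] by fastforce

text \<open>The translate x + U need not be open. Its points that have a whole translate of a base
  member inside x + U form an open set: if y + W lies in x + U and W' + W' \<subseteq> W, then each
  z in y + W' still has z + W' inside x + U.\<close>

lemma base_interior:
  assumes U: "U \<in> B" and x: "x \<in> V"
  shows "\<exists>S. openin base_topology S \<and> x \<in> S \<and> S \<subseteq> {y\<in>V. vdiff y x \<in> U}"
proof -
  define S where "S = {y\<in>V. \<exists>W\<in>B. \<forall>z\<in>V. vdiff z y \<in> W \<longrightarrow> vdiff z x \<in> U}"
  have "base_open S"
    unfolding base_open_def
  proof (intro conjI ballI)
    fix y assume y: "y \<in> S"
    then obtain W where W: "y \<in> V" "W \<in> B" "\<And>z. z \<in> V \<Longrightarrow> vdiff z y \<in> W \<Longrightarrow> vdiff z x \<in> U"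
      unfolding S_def by blast
    obtain W' where W': "W' \<in> B" "\<And>p q. p \<in> W' \<Longrightarrow> q \<in> W' \<Longrightarrow> add p q \<in> W"
      using base_add[OF W(2)] by blast
    have "z \<in> S" if z: "z \<in> V" "vdiff z y \<in> W'" for z
    proof -
      have "vdiff w x \<in> U" if w: "w \<in> V" "vdiff w z \<in> W'" for w
      proof -
        have "vdiff w y \<in> W"
          using W'(2)[OF w(2) z(2)] vdiff_vdiff_trans[OF w(1) z(1) W(1)] by simp
        then show ?thesis using W(3) w by blast
      qed
      then show ?thesis unfolding S_def using z W'(1) by blast
    qed
    then show "\<exists>U\<in>B. \<forall>z\<in>V. vdiff z y \<in> U \<longrightarrow> z \<in> S" using W'(1) by blast
  qed (auto simp: S_def)
  moreover have "x \<in> S" unfolding S_def using U x by blast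
  moreover have "S \<subseteq> {y\<in>V. vdiff y x \<in> U}"
    unfolding S_def using vdiff_self zero_in_base by fastforce
  ultimately show ?thesis using openin_base_topology by blast
qed

lemma nbhd_of_base_topology:
  assumes "x \<in> V"
  shows "nbhd_of base_topology x S \<longleftrightarrow> S \<subseteq> V \<and> (\<exists>U\<in>B. \<forall>y\<in>V. vdiff y x \<in> U \<longrightarrow> y \<in> S)"
proof
  assume "nbhd_of base_topology x S"
  then obtain W where W: "S \<subseteq> V" "openin base_topology W" "x \<in> W" "W \<subseteq> S"
    unfolding nbhd_of_def topspace_base_topology by blast
  then obtain U where "U \<in> B" "\<forall>y\<in>V. vdiff y x \<in> U \<longrightarrow> y \<in> W"
    unfolding openin_base_topology using base_openD by meson
  then show "S \<subseteq> V \<and> (\<exists>U\<in>B. \<forall>y\<in>V. vdiff y x \<in> U \<longrightarrow> y \<in> S)" using W by blast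
next
  assume "S \<subseteq> V \<and> (\<exists>U\<in>B. \<forall>y\<in>V. vdiff y x \<in> U \<longrightarrow> y \<in> S)"
  then obtain U where U: "S \<subseteq> V" "U \<in> B" "\<forall>y\<in>V. vdiff y x \<in> U \<longrightarrow> y \<in> S" by blast
  then obtain W where "openin base_topology W" "x \<in> W" "W \<subseteq> {y\<in>V. vdiff y x \<in> U}"
    using base_interior assms by meson
  then show "nbhd_of base_topology x S"
    unfolding nbhd_of_def topspace_base_topology using U by blast
qed

lemma nbhd_of_zero: "nbhd_of base_topology zero S \<longleftrightarrow> S \<subseteq> V \<and> (\<exists>U\<in>B. U \<subseteq> S)"
proof -
  have "(\<forall>y\<in>V. vdiff y zero \<in> U \<longrightarrow> y \<in> S) \<longleftrightarrow> U \<subseteq> S" if "U \<in> B" for U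
    using base_subset[OF that] by (auto simp: vdiff_zero)
  then show ?thesis
    unfolding nbhd_of_base_topology[OF zero_closed] by blast
qed

lemma nbhd_basis_base_topology: "nbhd_basis_at base_topology zero B"
  unfolding nbhd_basis_at_def nbhd_of_zero using base_subset by blast

text \<open>A common point z of the two neighbourhoods would give x - y = (x - z) + (z - y) in W + W
  \<subseteq> U. Since the neighbourhood of x controls z - x and not x - z, its base member is
  chosen by \<open>base_minus\<close>.\<close>

lemma Hausdorff_base_topology: "Hausdorff_space base_topology"
  unfolding Hausdorff_space_def topspace_base_topology
proof (intro allI impI, elim conjE)
  fix x y assume xy: "x \<in> V" "y \<in> V" "x \<noteq> y"
  have "vdiff x y \<noteq> zero" using vdiff_eq_zero xy by blast
  then obtain U where U: "U \<in> B" "vdiff x y \<notin> U"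
    using base_separating vdiff_closed xy by metis
  obtain W where W: "W \<in> B" "\<And>p q. p \<in> W \<Longrightarrow> q \<in> W \<Longrightarrow> add p q \<in> U"
    using base_add[OF U(1)] by blast
  obtain W' where W': "W' \<in> B" "\<And>p. p \<in> W' \<Longrightarrow> smul (-1) p \<in> W"
    using base_minus[OF W(1)] by blast
  obtain S where S: "openin base_topology S" "x \<in> S" "S \<subseteq> {z\<in>V. vdiff z x \<in> W'}"
    using base_interior[OF W'(1) xy(1)] by blast
  obtain S' where S': "openin base_topology S'" "y \<in> S'" "S' \<subseteq> {z\<in>V. vdiff z y \<in> W}"
    using base_interior[OF W(1) xy(2)] by blast
  have False if z: "z \<in> S" "z \<in> S'" for z
  proof -
    have zV: "z \<in> V" "vdiff z x \<in> W'" "vdiff z y \<in> W" using z S S' by auto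
    have "vdiff x z \<in> W" using W'(2)[OF zV(2)] minus_vdiff[OF zV(1) xy(1)] by simp
    then have "vdiff x y \<in> U" using W(2) zV vdiff_vdiff_trans[OF xy(1) zV(1) xy(2)] by metis
    then show False using U by blast
  qed
  then have "disjnt S S'" by (auto simp: disjnt_def)
  then show "\<exists>U Va. openin base_topology U \<and> openin base_topology Va \<and> x \<in> U \<and> y \<in> Va \<and> disjnt U Va"
    using S S' by blast
qed

lemma continuous_add_base_topology:
  "continuous_map (prod_topology base_topology base_topology) base_topology (\<lambda>(x, y). add x y)"
  unfolding continuous_map_def
proof (intro conjI allI impI)
  show "(\<lambda>(x, y). add x y)
      \<in> topspace (prod_topology base_topology base_topology) \<rightarrow> topspace base_topology"
    by (auto simp: topspace_base_topology add_closed)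
next
  fix O' assume O: "openin base_topology O'"
  show "openin (prod_topology base_topology base_topology)
     {p \<in> topspace (prod_topology base_topology base_topology). (case p of (x, y) \<Rightarrow> add x y) \<in> O'}"
    unfolding openin_prod_topology_alt
  proof (intro allI impI)
    fix x y
    assume "(x, y) \<in> {p \<in> topspace (prod_topology base_topology base_topology).
      (case p of (x, y) \<Rightarrow> add x y) \<in> O'}"
    then have xy: "x \<in> V" "y \<in> V" "add x y \<in> O'" by (auto simp: topspace_base_topology)
    obtain U where U: "U \<in> B" "\<And>z. z \<in> V \<Longrightarrow> vdiff z (add x y) \<in> U \<Longrightarrow> z \<in> O'"
      using base_openD[OF O[unfolded openin_base_topology] xy(3)] by blast
    obtain W where W: "W \<in> B" "\<And>p q. p \<in> W \<Longrightarrow> q \<in> W \<Longrightarrow> add p q \<in> U"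
      using base_add[OF U(1)] by blast
    obtain S where S: "openin base_topology S" "x \<in> S" "S \<subseteq> {z\<in>V. vdiff z x \<in> W}"
      using base_interior[OF W(1) xy(1)] by blast
    obtain S' where S': "openin base_topology S'" "y \<in> S'" "S' \<subseteq> {z\<in>V. vdiff z y \<in> W}"
      using base_interior[OF W(1) xy(2)] by blast
    have "add u v \<in> O'" if "u \<in> S" "v \<in> S'" for u v
    proof (rule U(2))
      have uv: "u \<in> V" "v \<in> V" "vdiff u x \<in> W" "vdiff v y \<in> W" using that S S' by auto
      then show "add u v \<in> V" by (simp add: add_closed)
      show "vdiff (add u v) (add x y) \<in> U" using W uv xy by (simp add: vdiff_add_add)
    qed
    then have "S \<times> S' \<subseteq> {p \<in> topspace (prod_topology base_topology base_topology).
      (case p of (x, y) \<Rightarrow> add x y) \<in> O'}"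
      using S(3) S'(3) by (auto simp: topspace_base_topology)
    then show "\<exists>S S'. openin base_topology S \<and> openin base_topology S' \<and> x \<in> S \<and> y \<in> S'
      \<and> S \<times> S' \<subseteq> {p \<in> topspace (prod_topology base_topology base_topology).
            (case p of (x, y) \<Rightarrow> add x y) \<in> O'}"
      using S S' by blast
  qed
qed

text \<open>Splits b y - a x = b (y - x) + (b - a) x. The first summand is small uniformly in
  \<open>norm b \<le> norm a + 1\<close> by \<open>base_scale\<close>, the second by
  \<open>base_absorbing\<close>.\<close>

lemma continuous_scale_base_topology:
  "continuous_map (prod_topology euclidean base_topology) base_topology (\<lambda>(a, x). smul a x)"
  unfolding continuous_map_def
proof (intro conjI allI impI)
  show "(\<lambda>(a, x). smul a x)
      \<in> topspace (prod_topology euclidean base_topology) \<rightarrow> topspace base_topology"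
    by (auto simp: topspace_base_topology scale_closed)
next
  fix O' assume O: "openin base_topology O'"
  show "openin (prod_topology euclidean base_topology)
     {p \<in> topspace (prod_topology euclidean base_topology). (case p of (a, x) \<Rightarrow> smul a x) \<in> O'}"
    unfolding openin_prod_topology_alt
  proof (intro allI impI)
    fix a x
    assume "(a, x) \<in> {p \<in> topspace (prod_topology euclidean base_topology).
      (case p of (a, x) \<Rightarrow> smul a x) \<in> O'}"
    then have x: "x \<in> V" "smul a x \<in> O'" by (auto simp: topspace_base_topology)
    obtain U where U: "U \<in> B" "\<And>z. z \<in> V \<Longrightarrow> vdiff z (smul a x) \<in> U \<Longrightarrow> z \<in> O'"
      using base_openD[OF O[unfolded openin_base_topology] x(2)] by blast
    obtain W where W: "W \<in> B" "\<And>p q. p \<in> W \<Longrightarrow> q \<in> W \<Longrightarrow> add p q \<in> U"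
      using base_add[OF U(1)] by blast
    obtain W' where W': "W' \<in> B" "\<And>z b. z \<in> W' \<Longrightarrow> norm b \<le> norm a + 1 \<Longrightarrow> smul b z \<in> W"
      using base_scale[OF W(1)] by blast
    obtain e where e: "e > 0" "\<And>b. norm b < e \<Longrightarrow> smul b x \<in> W"
      using base_absorbing[OF W(1) x(1)] by blast
    obtain S where S: "openin base_topology S" "x \<in> S" "S \<subseteq> {z\<in>V. vdiff z x \<in> W'}"
      using base_interior[OF W'(1) x(1)] by blast
    have "smul b y \<in> O'" if b: "b \<in> ball a (min e 1)" and y: "y \<in> S" for b y
    proof (rule U(2))
      have yV: "y \<in> V" "vdiff y x \<in> W'" using y S by auto
      have ba: "norm (b - a) < e" "norm (b - a) < 1"
        using b by (auto simp: dist_norm norm_minus_commute)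
      then have "norm b \<le> norm a + 1" using norm_triangle_ineq2[of b a] by linarith
      then have "vdiff (smul b y) (smul b x) \<in> W"
        using W'(2)[OF yV(2)] scale_vdiff[OF yV(1) x(1)] by metis
      moreover have "vdiff (smul b x) (smul a x) \<in> W"
        using e(2) ba(1) vdiff_scale_left[OF x(1)] by simp
      ultimately show "vdiff (smul b y) (smul a x) \<in> U"
        using W(2) vdiff_vdiff_trans scale_closed x(1) yV(1) by metis
      show "smul b y \<in> V" using yV by (simp add: scale_closed)
    qed
    then have "ball a (min e 1) \<times> S \<subseteq> {p \<in> topspace (prod_topology euclidean base_topology).
      (case p of (a, x) \<Rightarrow> smul a x) \<in> O'}"
      using S(3) by (auto simp: topspace_base_topology)
    moreover have "openin euclidean (ball a (min e 1))" "a \<in> ball a (min e 1)"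
      using e(1) by auto
    ultimately show "\<exists>S S'. openin euclidean S \<and> openin base_topology S' \<and> a \<in> S \<and> x \<in> S'
      \<and> S \<times> S' \<subseteq> {p \<in> topspace (prod_topology euclidean base_topology).
            (case p of (a, x) \<Rightarrow> smul a x) \<in> O'}"
      using S by blast
  qed
qed

lemma topological_vector_space_base_topology:
  "topological_vector_space_on V add zero smul base_topology"
  by unfold_locales
    (simp_all add: topspace_base_topology Hausdorff_base_topology
      continuous_add_base_topology continuous_scale_base_topology)

text \<open>Reduces completeness to differences and members of the base, the form in which the
  measures of level sets can be estimated.\<close>

lemma complete_base_topology:
  assumes "\<And>(I :: ('v set \<times> 'v) set) le x.
      directed_set I le \<Longrightarrow> x ` I \<subseteq> V \<Longrightarrow>
      (\<And>U. U \<in> B \<Longrightarrow> \<exists>k\<in>I. \<forall>i\<in>I. \<forall>j\<in>I. le k i \<longrightarrow> le k j \<longrightarrow> vdiff (x i) (x j) \<in> U) \<Longrightarrow>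
      \<exists>l\<in>V. \<forall>U\<in>B. \<exists>k\<in>I. \<forall>i\<in>I. le k i \<longrightarrow> vdiff (x i) l \<in> U"
  shows "complete_tvs add zero smul base_topology"
  unfolding complete_tvs_def topspace_base_topology
proof (intro allI impI)
  fix I :: "('v set \<times> 'v) set" and le x
  assume I: "directed_set I le" "x ` I \<subseteq> V" and C: "cauchy_net add zero smul base_topology I le x"
  have "\<exists>k\<in>I. \<forall>i\<in>I. \<forall>j\<in>I. le k i \<longrightarrow> le k j \<longrightarrow> vdiff (x i) (x j) \<in> U" if "U \<in> B" for U
    using C that base_subset[OF that] unfolding cauchy_net_def nbhd_of_zero vdiff_def by blast
  then obtain l where l: "l \<in> V" "\<And>U. U \<in> B \<Longrightarrow> \<exists>k\<in>I. \<forall>i\<in>I. le k i \<longrightarrow> vdiff (x i) l \<in> U"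
    using assms[OF I] by blast
  have "net_converges base_topology I le x l"
    unfolding net_converges_def topspace_base_topology nbhd_of_base_topology[OF l(1)]
  proof (intro conjI allI impI)
    fix S assume "S \<subseteq> V \<and> (\<exists>U\<in>B. \<forall>y\<in>V. vdiff y l \<in> U \<longrightarrow> y \<in> S)"
    then obtain U where U: "U \<in> B" "\<forall>y\<in>V. vdiff y l \<in> U \<longrightarrow> y \<in> S" by blast
    obtain k where "k \<in> I" "\<forall>i\<in>I. le k i \<longrightarrow> vdiff (x i) l \<in> U"
      using l(2)[OF U(1)] by blast
    then show "\<exists>k\<in>I. \<forall>i\<in>I. le k i \<longrightarrow> x i \<in> S"
      using U(2) I(2) by (intro bexI[of _ k]) auto
  qed (rule l(1))
  then show "\<exists>l. net_converges base_topology I le x l" ..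
qed

end

section \<open>Quasi-norms and strong measurability\<close>

context quasi_normed_space
begin

text \<open>The constant is normalised to be at least 1, so that it is positive and the later
  geometric rate \<open>ratio\<close> lies below 1.\<close>

definition qconst :: real where
  "qconst = (SOME K. 1 \<le> K \<and> (\<forall>x y. qn (x + y) \<le> K * (qn x + qn y)))"

lemma qconst_ge_1: "1 \<le> qconst" and qn_add_le: "qn (x + y) \<le> qconst * (qn x + qn y)"
proof -
  obtain k where k: "\<And>x y. qn (x + y) \<le> k * (qn x + qn y)" using qn_quasi_triangle by blast
  have "qn (x + y) \<le> max 1 k * (qn x + qn y)" for x y
    using k[of x y] mult_right_mono[of k "max 1 k" "qn x + qn y"] qn_nonneg[of x] qn_nonneg[of y]
    by linarith
  then have "1 \<le> max 1 k \<and> (\<forall>x y. qn (x + y) \<le> max 1 k * (qn x + qn y))" by simp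
  then have "1 \<le> qconst \<and> (\<forall>x y. qn (x + y) \<le> qconst * (qn x + qn y))"
    unfolding qconst_def by (rule someI)
  then show "1 \<le> qconst" "qn (x + y) \<le> qconst * (qn x + qn y)" by auto
qed

lemma qconst_pos: "0 < qconst"
  using qconst_ge_1 by simp

lemma qn_add_le_mono:
  assumes "qn x \<le> s" "qn y \<le> t"
  shows "qn (x + y) \<le> qconst * (s + t)"
  using qn_add_le[of x y] mult_left_mono[of "qn x + qn y" "s + t" qconst] assms qconst_pos
  by linarith

lemma qn_zero [simp]: "qn 0 = 0"
  using qn_scale[of 0 0] by simp

lemma qn_minus: "qn (- x) = qn x"
  using qn_scale[of "-1" x] by (simp add: scale_minus_left)

lemma qn_minus_commute: "qn (x - y) = qn (y - x)"
  using qn_minus[of "x - y"] by simp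

lemma qn_diff_le_mono:
  assumes "qn (x - y) \<le> s" "qn (y - z) \<le> t"
  shows "qn (x - z) \<le> qconst * (s + t)"
  using qn_add_le_mono[OF assms] by simp

lemma openin_qn_topology_translate:
  assumes "openin (qn_topology qn) U"
  shows "openin (qn_topology qn) {x. x - c \<in> U}"
  unfolding openin_qn_topology
proof
  fix x assume "x \<in> {x. x - c \<in> U}"
  then obtain e where e: "e > 0" "\<And>y. qn (y - (x - c)) \<le> e \<Longrightarrow> y \<in> U"
    using assms unfolding openin_qn_topology by blast
  have "y - c \<in> U" if "qn (y - x) \<le> e" for y
    using e(2)[of "y - c"] that by simp
  then show "\<exists>e>0. \<forall>y. qn (y - x) \<le> e \<longrightarrow> y \<in> {x. x - c \<in> U}" using e(1) by blast
qed

lemma openin_qn_topology_scale: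
  assumes "openin (qn_topology qn) U"
  shows "openin (qn_topology qn) {x. smul c x \<in> U}"
  unfolding openin_qn_topology
proof
  fix x assume "x \<in> {x. smul c x \<in> U}"
  then obtain e where e: "e > 0" "\<And>y. qn (y - smul c x) \<le> e \<Longrightarrow> y \<in> U"
    using assms unfolding openin_qn_topology by blast
  \<comment> \<open>Dividing by \<open>norm c + 1\<close> instead of \<open>norm c\<close> covers c
    = 0.\<close>
  have "smul c y \<in> U" if "qn (y - x) \<le> e / (norm c + 1)" for y
  proof -
    have "qn (smul c y - smul c x) = norm c * qn (y - x)"
      by (simp add: scale_right_diff_distrib[symmetric] qn_scale)
    also have "\<dots> \<le> (norm c + 1) * (e / (norm c + 1))"
      using that qn_nonneg by (intro mult_mono) auto
    also have "\<dots> = e"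
      using norm_ge_zero[of c] by (simp add: add_nonneg_eq_0_iff)
    finally show ?thesis by (rule e(2))
  qed
  then show "\<exists>e>0. \<forall>y. qn (y - x) \<le> e \<longrightarrow> y \<in> {x. smul c x \<in> U}"
    using e(1) by (intro exI[of _ "e / (norm c + 1)"]) (simp add: add_nonneg_pos)
qed

text \<open>The approximating points need not lie in the set itself.\<close>

definition qn_separable :: "'x set \<Rightarrow> bool" where
  "qn_separable Y \<longleftrightarrow> (\<exists>D. countable D \<and> (\<forall>y\<in>Y. \<forall>e>0. \<exists>d\<in>D. qn (y - d) < e))"

text \<open>A pointwise limit of functions with values in \<open>Z\<close> takes its values only in
  the closure of \<open>Z\<close>, so the closure has to remain a separable subspace.\<close>

definition qn_closure :: "'x set \<Rightarrow> 'x set" where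
  "qn_closure Z = {x. \<forall>e>0. \<exists>z\<in>Z. qn (x - z) < e}"

lemma qn_separable_closure:
  assumes "qn_separable Z"
  shows "qn_separable (qn_closure Z)"
proof -
  obtain D where D: "countable D" "\<And>y e. y \<in> Z \<Longrightarrow> e > 0 \<Longrightarrow> \<exists>d\<in>D. qn (y - d) < e"
    using assms unfolding qn_separable_def by blast
  have "\<exists>d\<in>D. qn (x - d) < e" if x: "x \<in> qn_closure Z" and e: "e > 0" for x e
  proof -
    \<comment> \<open>Two errors below r add up to at most \<open>qconst * (r + r)\<close> = e/2,
      which leaves the strict inequality intact.\<close>
    define r where "r = e / (4 * qconst)"
    have r: "r > 0" "qconst * (r + r) < e" using e qconst_pos by (simp_all add: r_def)
    obtain z where z: "z \<in> Z" "qn (x - z) < r" using x r(1) unfolding qn_closure_def by blast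
    obtain d where d: "d \<in> D" "qn (z - d) < r" using D(2)[OF z(1) r(1)] by blast
    have "qn (x - d) \<le> qconst * (r + r)" using z d by (intro qn_diff_le_mono[of _ z]) auto
    then show ?thesis using d(1) r(2) by force
  qed
  then show ?thesis unfolding qn_separable_def using D(1) by blast
qed

lemma qn_separable_sums:
  assumes "qn_separable Y" "qn_separable Z"
  shows "qn_separable {y + z | y z. y \<in> Y \<and> z \<in> Z}"
proof -
  obtain D where D: "countable D" "\<And>y e. y \<in> Y \<Longrightarrow> e > 0 \<Longrightarrow> \<exists>d\<in>D. qn (y - d) < e"
    using assms(1) unfolding qn_separable_def by blast
  obtain D' where D': "countable D'" "\<And>y e. y \<in> Z \<Longrightarrow> e > 0 \<Longrightarrow> \<exists>d\<in>D'. qn (y - d) < e"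
    using assms(2) unfolding qn_separable_def by blast
  let ?S = "(\<lambda>(d, d'). d + d') ` (D \<times> D')"
  have "\<exists>d\<in>?S. qn (y + z - d) < e" if yz: "y \<in> Y" "z \<in> Z" and e: "e > 0" for y z e
  proof -
    define r where "r = e / (4 * qconst)"
    have r: "r > 0" "qconst * (r + r) < e" using e qconst_pos by (simp_all add: r_def)
    obtain d where d: "d \<in> D" "qn (y - d) < r" using D(2)[OF yz(1) r(1)] by blast
    obtain d' where d': "d' \<in> D'" "qn (z - d') < r" using D'(2)[OF yz(2) r(1)] by blast
    have "qn ((y - d) + (z - d')) \<le> qconst * (r + r)" using d d' by (intro qn_add_le_mono) auto
    then have "qn (y + z - (d + d')) < e" using r(2) by (simp add: algebra_simps)
    then show ?thesis using d(1) d'(1) by force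
  qed
  then have "\<forall>x\<in>{y + z | y z. y \<in> Y \<and> z \<in> Z}. \<forall>e>0. \<exists>d\<in>?S. qn (x - d) < e" by blast
  moreover have "countable ?S" using D(1) D'(1) by simp
  ultimately show ?thesis unfolding qn_separable_def by blast
qed

lemma qn_separable_UN:
  assumes "\<And>n::nat. qn_separable (Y n)"
  shows "qn_separable (\<Union>n. Y n)"
proof -
  obtain D where D: "\<And>n. countable (D n)" "\<And>n y e. y \<in> Y n \<Longrightarrow> e > 0 \<Longrightarrow> \<exists>d\<in>D n. qn (y - d) < e"
    using assms unfolding qn_separable_def by metis
  have "countable (\<Union>n. D n)" using D(1) by simp
  then show ?thesis unfolding qn_separable_def using D(2) by (intro exI[of _ "\<Union>n. D n"]) blast
qed

lemma subspace_qn_closure: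
  assumes Z: "subspace Z"
  shows "subspace (qn_closure Z)"
proof (rule subspaceI)
  show "0 \<in> qn_closure Z"
    unfolding qn_closure_def using subspace_0[OF Z] by (auto intro!: bexI[of _ 0])
next
  fix x y assume xy: "x \<in> qn_closure Z" "y \<in> qn_closure Z"
  show "x + y \<in> qn_closure Z"
    unfolding qn_closure_def
  proof (intro CollectI allI impI)
    fix e :: real assume e: "e > 0"
    define r where "r = e / (4 * qconst)"
    have r: "r > 0" "qconst * (r + r) < e" using e qconst_pos by (simp_all add: r_def)
    obtain d where d: "d \<in> Z" "qn (x - d) < r" using xy r unfolding qn_closure_def by blast
    obtain d' where d': "d' \<in> Z" "qn (y - d') < r" using xy r unfolding qn_closure_def by blast
    have "qn ((x - d) + (y - d')) \<le> qconst * (r + r)" using d d' by (intro qn_add_le_mono) auto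
    then have "qn (x + y - (d + d')) < e" using r(2) by (simp add: algebra_simps)
    then show "\<exists>z\<in>Z. qn (x + y - z) < e" using subspace_add[OF Z d(1) d'(1)] by blast
  qed
next
  fix c x assume x: "x \<in> qn_closure Z"
  show "smul c x \<in> qn_closure Z"
    unfolding qn_closure_def
  proof (intro CollectI allI impI)
    fix e :: real assume e: "e > 0"
    have "e / (norm c + 1) > 0" using e by (simp add: add_nonneg_pos)
    then obtain z where z: "z \<in> Z" "qn (x - z) < e / (norm c + 1)"
      using x unfolding qn_closure_def by blast
    have "qn (smul c x - smul c z) = norm c * qn (x - z)"
      by (simp add: scale_right_diff_distrib[symmetric] qn_scale)
    also have "\<dots> \<le> (norm c + 1) * qn (x - z)"
      using qn_nonneg by (intro mult_right_mono) auto
    also have "\<dots> < e"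
      using z(2) by (simp add: pos_less_divide_eq add_nonneg_pos mult.commute)
    finally show "\<exists>z\<in>Z. qn (smul c x - z) < e" using subspace_scale[OF Z z(1)] by blast
  qed
qed

section \<open>Borel measurability for the quasi-norm topology\<close>

lemma openin_qn_measurable: "openin (qn_topology qn) U \<Longrightarrow> U \<in> sets (qn_borel qn)"
  unfolding qn_borel_def by auto

lemma space_qn_borel [simp]: "space (qn_borel qn) = UNIV"
  unfolding qn_borel_def by simp

lemma measurable_qn_borelI:
  assumes "\<And>U. openin (qn_topology qn) U \<Longrightarrow> {\<omega>\<in>space M. f \<omega> \<in> U} \<in> sets M"
  shows "f \<in> measurable M (qn_borel qn)"
  unfolding qn_borel_def
proof (rule measurable_measure_of)
  show "f -` U \<inter> space M \<in> sets M" if "U \<in> {U. openin (qn_topology qn) U}" for U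
    using assms[of U] that by (simp add: vimage_def Int_def conj_commute)
qed auto

lemma measurable_qn_borelD:
  assumes "f \<in> measurable M (qn_borel qn)" "openin (qn_topology qn) U"
  shows "{\<omega>\<in>space M. f \<omega> \<in> U} \<in> sets M"
  using measurable_sets[OF assms(1) openin_qn_measurable[OF assms(2)]]
  by (simp add: vimage_def Int_def conj_commute)

end

locale continuous_quasi_norm = quasi_normed_space smul qn
  for smul :: "'k::real_normed_field \<Rightarrow> 'x::ab_group_add \<Rightarrow> 'x" and qn :: "'x \<Rightarrow> real" +
  assumes continuous_qn: "continuous_map (qn_topology qn) euclideanreal qn"
begin

text \<open>A strict ball of a general quasi-norm need not be open in the induced topology.
  Continuity of \<open>qn\<close> makes it open at 0, and translation does the rest.\<close>

lemma openin_qn_ball: "openin (qn_topology qn) {x. qn (x - c) < r}"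
proof -
  have "openin (qn_topology qn) {x \<in> topspace (qn_topology qn). qn x \<in> {..<r}}"
    using continuous_qn by (rule openin_continuous_map_preimage) simp
  from openin_qn_topology_translate[OF this, of c] show ?thesis by simp
qed

lemma borel_measurable_qn:
  assumes "f \<in> measurable M (qn_borel qn)"
  shows "(\<lambda>\<omega>. qn (f \<omega>)) \<in> borel_measurable M"
  unfolding borel_measurable_iff_less
  using measurable_qn_borelD[OF assms openin_qn_ball[of 0]] by simp

text \<open>Balls intersected with \<open>Y\<close> are open in \<open>Y\<close>, so a dense subset
  approximates. Conversely the approximating points d may lie outside \<open>Y\<close>; for each d
  and each radius 1/(n+1) one point of \<open>Y\<close> near d is picked if there is any, and these
  countably many points are dense in \<open>Y\<close>.\<close>

lemma separable_space_qn:
  "separable_space (subtopology (qn_topology qn) Y) \<longleftrightarrow> qn_separable Y"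
proof
  assume "separable_space (subtopology (qn_topology qn) Y)"
  then obtain C where C: "countable C" "C \<subseteq> Y" "subtopology (qn_topology qn) Y closure_of C = Y"
    unfolding separable_space_def by auto
  have "\<exists>d\<in>C. qn (y - d) < e" if y: "y \<in> Y" and e: "e > 0" for y e
  proof -
    have "openin (subtopology (qn_topology qn) Y) (Y \<inter> {x. qn (x - y) < e})"
      using openin_qn_ball by (rule openin_subtopology_Int2)
    moreover have "y \<in> Y \<inter> {x. qn (x - y) < e}" using y e by simp
    moreover have "y \<in> subtopology (qn_topology qn) Y closure_of C" using C(3) y by simp
    then have "\<forall>T. y \<in> T \<and> openin (subtopology (qn_topology qn) Y) T \<longrightarrow> (\<exists>d. d \<in> C \<and> d \<in> T)"
      unfolding in_closure_of by (rule conjunct2)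
    ultimately obtain d where "d \<in> C" "d \<in> Y \<inter> {x. qn (x - y) < e}" by meson
    then show ?thesis using qn_minus_commute[of d y] by (intro bexI[of _ d]) simp_all
  qed
  then show "qn_separable Y" unfolding qn_separable_def using C(1) by blast
next
  assume "qn_separable Y"
  then obtain D where D: "countable D" "\<And>y e. y \<in> Y \<Longrightarrow> e > 0 \<Longrightarrow> \<exists>d\<in>D. qn (y - d) < e"
    unfolding qn_separable_def by blast
  define near where "near d n = (SOME y. y \<in> Y \<and> qn (y - d) < 1 / real (Suc n))" for d n
  define C where "C = {near d n | d n. d \<in> D \<and> (\<exists>y\<in>Y. qn (y - d) < 1 / real (Suc n))}"
  have near: "near d n \<in> Y" "qn (near d n - d) < 1 / real (Suc n)"
    if "\<exists>y\<in>Y. qn (y - d) < 1 / real (Suc n)" for d n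
    using someI_ex[of "\<lambda>y. y \<in> Y \<and> qn (y - d) < 1 / real (Suc n)"] that
    unfolding near_def by blast+
  have "C \<subseteq> (\<lambda>(d, n). near d n) ` (D \<times> UNIV)" unfolding C_def by auto
  then have "countable C" using D(1) by (meson countable_SIGMA countable_image countable_subset countableI_type)
  moreover have CY: "C \<subseteq> Y" using near unfolding C_def by blast
  moreover have "y \<in> subtopology (qn_topology qn) Y closure_of C" if y: "y \<in> Y" for y
    unfolding in_closure_of
  proof (intro conjI allI impI)
    fix T assume "y \<in> T \<and> openin (subtopology (qn_topology qn) Y) T"
    then obtain U where U: "openin (qn_topology qn) U" "T = U \<inter> Y" "y \<in> U"
      unfolding openin_subtopology by blast
    then obtain e where e: "e > 0" "\<And>z. qn (z - y) \<le> e \<Longrightarrow> z \<in> U"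
      unfolding openin_qn_topology by blast
    have "e / (2 * qconst) > 0" using e(1) qconst_pos by simp
    then obtain n where n: "1 / real (Suc n) < e / (2 * qconst)"
      using nat_approx_posE by blast
    obtain d where d: "d \<in> D" "qn (y - d) < 1 / real (Suc n)" using D(2)[OF y, of "1 / real (Suc n)"] by auto
    have "qn (d - y) \<le> e / (2 * qconst)" using d(2) n qn_minus_commute[of d y] by linarith
    \<comment> \<open>The point y itself is within 1/(n+1) of d, so the choice defining
      \<open>near d n\<close> is not void.\<close>
    moreover have nr: "near d n \<in> Y" "qn (near d n - d) < 1 / real (Suc n)"
      using near[of d n] y d(2) by blast+
    ultimately have "qn (near d n - y) \<le> qconst * (e / (2 * qconst) + e / (2 * qconst))"
      using n by (intro qn_diff_le_mono[of _ d]) auto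
    also have "\<dots> = e" using qconst_pos by (simp add: field_simps)
    finally have "near d n \<in> T" using e(2) U(2) nr(1) by blast
    moreover have "near d n \<in> C" unfolding C_def using d y by blast
    ultimately show "\<exists>z. z \<in> C \<and> z \<in> T" by blast
  qed (use y in simp)
  ultimately show "separable_space (subtopology (qn_topology qn) Y)"
    unfolding separable_space_def using closure_of_subset_topspace
    by (intro exI[of _ C]) fastforce
qed

section \<open>Sums, multiples and limits of strongly measurable functions\<close>

lemma strongly_measurable_iff:
  "f \<in> strongly_measurable M smul qn \<longleftrightarrow>
     f \<in> measurable M (qn_borel qn) \<and> (\<exists>Y. subspace Y \<and> qn_separable Y \<and> (AE \<omega> in M. f \<omega> \<in> Y))"
  unfolding strongly_measurable_def separable_space_qn by simp

lemma strongly_measurable_zero: "(\<lambda>\<omega>. 0) \<in> strongly_measurable M smul qn"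
proof -
  have "qn_separable {0}" unfolding qn_separable_def by (intro exI[of _ "{0}"]) simp
  moreover have "(\<lambda>\<omega>. 0) \<in> measurable M (qn_borel qn)" by simp
  ultimately show ?thesis
    unfolding strongly_measurable_iff by (intro conjI exI[of _ "{0}"]) simp_all
qed

lemma strongly_measurable_scale:
  assumes "f \<in> strongly_measurable M smul qn"
  shows "(\<lambda>\<omega>. smul c (f \<omega>)) \<in> strongly_measurable M smul qn"
proof -
  obtain Y where f: "f \<in> measurable M (qn_borel qn)" and Y: "subspace Y" "qn_separable Y"
    and fY: "AE \<omega> in M. f \<omega> \<in> Y"
    using assms unfolding strongly_measurable_iff by blast
  have "(\<lambda>\<omega>. smul c (f \<omega>)) \<in> measurable M (qn_borel qn)"
  proof (rule measurable_qn_borelI)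
    fix U assume "openin (qn_topology qn) U"
    from measurable_qn_borelD[OF f openin_qn_topology_scale[OF this, of c]]
    show "{\<omega>\<in>space M. smul c (f \<omega>) \<in> U} \<in> sets M" by simp
  qed
  moreover have "AE \<omega> in M. smul c (f \<omega>) \<in> Y" using fY by eventually_elim (rule subspace_scale[OF Y(1)])
  ultimately show ?thesis unfolding strongly_measurable_iff using Y by blast
qed

lemma measurable_zero_on:
  assumes "f \<in> measurable M (qn_borel qn)" "N \<in> sets M"
  shows "(\<lambda>\<omega>. if \<omega> \<in> N then 0 else f \<omega>) \<in> measurable M (qn_borel qn)"
  by (rule measurable_If_set) (use assms in auto)

text \<open>Addition need not be measurable for the product of two Borel \<sigma>-algebras in a
  nonseparable space. Once both functions take values in separable subspaces everywhere, the
  preimage of an open set is a countable union of intersections of preimages of balls centred at the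
  approximating points.\<close>

lemma strongly_measurable_add:
  assumes "f \<in> strongly_measurable M smul qn" "g \<in> strongly_measurable M smul qn"
  shows "\<exists>h\<in>strongly_measurable M smul qn. AE \<omega> in M. h \<omega> = f \<omega> + g \<omega>"
proof -
  obtain Y where f: "f \<in> measurable M (qn_borel qn)" and Y: "subspace Y" "qn_separable Y"
    and fY: "AE \<omega> in M. f \<omega> \<in> Y"
    using assms(1) unfolding strongly_measurable_iff by blast
  obtain Z where g: "g \<in> measurable M (qn_borel qn)" and Z: "subspace Z" "qn_separable Z"
    and gZ: "AE \<omega> in M. g \<omega> \<in> Z"
    using assms(2) unfolding strongly_measurable_iff by blast
  obtain D where D: "countable D" "\<And>y e. y \<in> Y \<Longrightarrow> e > 0 \<Longrightarrow> \<exists>d\<in>D. qn (y - d) < e"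
    using Y(2) unfolding qn_separable_def by blast
  obtain D' where D': "countable D'" "\<And>y e. y \<in> Z \<Longrightarrow> e > 0 \<Longrightarrow> \<exists>d\<in>D'. qn (y - d) < e"
    using Z(2) unfolding qn_separable_def by blast
  have "AE \<omega> in M. f \<omega> \<in> Y \<and> g \<omega> \<in> Z" using fY gZ by eventually_elim simp
  then obtain N where N: "N \<in> null_sets M" "\<And>\<omega>. \<omega> \<in> space M - N \<Longrightarrow> f \<omega> \<in> Y \<and> g \<omega> \<in> Z"
    by (rule AE_E3) blast
  define f' where "f' \<omega> = (if \<omega> \<in> N then 0 else f \<omega>)" for \<omega>
  define g' where "g' \<omega> = (if \<omega> \<in> N then 0 else g \<omega>)" for \<omega>
  have f': "f' \<in> measurable M (qn_borel qn)" and g': "g' \<in> measurable M (qn_borel qn)"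
    using measurable_zero_on f g N(1) unfolding f'_def g'_def by (auto simp: null_sets_def)
  have f'Y: "f' \<omega> \<in> Y" and g'Z: "g' \<omega> \<in> Z" if "\<omega> \<in> space M" for \<omega>
    using that N(2)[of \<omega>] subspace_0[OF Y(1)] subspace_0[OF Z(1)] by (auto simp: f'_def g'_def)
  have "(\<lambda>\<omega>. f' \<omega> + g' \<omega>) \<in> measurable M (qn_borel qn)"
  proof (rule measurable_qn_borelI)
    fix U assume U: "openin (qn_topology qn) U"
    \<comment> \<open>Indices of pairs of balls whose sum lies in \<open>U\<close>; there are
      countably many because the radii are 1/(n+1) and the centres come from \<open>D\<close> and
      \<open>D'\<close>.\<close>
    define P where "P = {(d, d', n). d \<in> D \<and> d' \<in> D' \<and>
      (\<forall>x y. qn (x - d) < 1 / real (Suc n) \<longrightarrow> qn (y - d') < 1 / real (Suc n) \<longrightarrow> x + y \<in> U)}"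
    define A where "A = (\<lambda>(d, d', n). {\<omega>\<in>space M. f' \<omega> \<in> {x. qn (x - d) < 1 / real (Suc n)}}
      \<inter> {\<omega>\<in>space M. g' \<omega> \<in> {x. qn (x - d') < 1 / real (Suc n)}})"
    have "P \<subseteq> D \<times> D' \<times> UNIV" unfolding P_def by auto
    then have "countable P" using D(1) D'(1)
      by (meson countable_SIGMA countable_subset countableI_type)
    moreover have "A p \<in> sets M" for p
      unfolding A_def using measurable_qn_borelD[OF f' openin_qn_ball] measurable_qn_borelD[OF g' openin_qn_ball]
      by (cases p) auto
    ultimately have "(\<Union>p\<in>P. A p) \<in> sets M" by blast
    moreover have "{\<omega>\<in>space M. f' \<omega> + g' \<omega> \<in> U} = (\<Union>p\<in>P. A p)"
    proof (intro equalityI subsetI)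
      fix \<omega> assume "\<omega> \<in> {\<omega>\<in>space M. f' \<omega> + g' \<omega> \<in> U}"
      then have \<omega>: "\<omega> \<in> space M" "f' \<omega> + g' \<omega> \<in> U" by auto
      obtain e where e: "e > 0" "\<And>z. qn (z - (f' \<omega> + g' \<omega>)) \<le> e \<Longrightarrow> z \<in> U"
        using U \<omega>(2) unfolding openin_qn_topology by blast
      \<comment> \<open>Writing K for \<open>qconst\<close>: points of a ball of radius r are within
        2 K r of each other, and adding the errors of two balls costs a further factor K, in total 4
        K K r.\<close>
      have "e / (4 * qconst * qconst) > 0" using e(1) qconst_pos by simp
      then obtain n where n: "1 / real (Suc n) < e / (4 * qconst * qconst)"
        using nat_approx_posE by blast
      define r where "r = 1 / real (Suc n)"
      have "r * (4 * qconst * qconst) < e"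
        using n qconst_pos unfolding r_def[symmetric] by (simp add: pos_less_divide_eq)
      then have r: "r > 0" "qconst * (qconst * (r + r) + qconst * (r + r)) \<le> e"
        by (simp_all add: r_def[symmetric] algebra_simps) (simp add: r_def)
      obtain d where d: "d \<in> D" "qn (f' \<omega> - d) < r" using D(2)[OF f'Y[OF \<omega>(1)] r(1)] by blast
      obtain d' where d': "d' \<in> D'" "qn (g' \<omega> - d') < r" using D'(2)[OF g'Z[OF \<omega>(1)] r(1)] by blast
      have "x + y \<in> U" if xy: "qn (x - d) < r" "qn (y - d') < r" for x y
      proof (rule e(2))
        have "qn (x - f' \<omega>) \<le> qconst * (r + r)"
          using xy d qn_minus_commute[of d "f' \<omega>"] by (intro qn_diff_le_mono[of _ d]) auto
        moreover have "qn (y - g' \<omega>) \<le> qconst * (r + r)"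
          using xy d' qn_minus_commute[of d' "g' \<omega>"] by (intro qn_diff_le_mono[of _ d']) auto
        ultimately have "qn ((x - f' \<omega>) + (y - g' \<omega>)) \<le> qconst * (qconst * (r + r) + qconst * (r + r))"
          by (rule qn_add_le_mono)
        then show "qn (x + y - (f' \<omega> + g' \<omega>)) \<le> e" using r(2) by (simp add: algebra_simps)
      qed
      then have "(d, d', n) \<in> P" using d d' by (simp add: P_def r_def)
      moreover have "\<omega> \<in> A (d, d', n)" using \<omega> d d' by (simp add: A_def r_def)
      ultimately show "\<omega> \<in> (\<Union>p\<in>P. A p)" by blast
    qed (auto simp: P_def A_def)
    ultimately show "{\<omega>\<in>space M. f' \<omega> + g' \<omega> \<in> U} \<in> sets M" by simp
  qed
  moreover have "AE \<omega> in M. f' \<omega> + g' \<omega> \<in> {y + z | y z. y \<in> Y \<and> z \<in> Z}"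
    using f'Y g'Z by (intro AE_I2) blast
  ultimately have "(\<lambda>\<omega>. f' \<omega> + g' \<omega>) \<in> strongly_measurable M smul qn"
    unfolding strongly_measurable_iff
    using subspace_sums[OF Y(1) Z(1)] qn_separable_sums[OF Y(2) Z(2)] by blast
  moreover have "AE \<omega> in M. f' \<omega> + g' \<omega> = f \<omega> + g \<omega>"
    using AE_not_in[OF N(1)] by eventually_elim (simp add: f'_def g'_def)
  ultimately show ?thesis by (intro bexI[of _ "\<lambda>\<omega>. f' \<omega> + g' \<omega>"])
qed

text \<open>A point lies in the closed set \<open>C\<close> iff it lies in each of the open neighbourhoods
  \<open>C\<^sub>r = {x. \<exists>c\<in>C. qn (x - c) < r}\<close>.\<close>

lemma measurable_qn_borel_limit:
  assumes f: "\<And>n::nat. f n \<in> measurable M (qn_borel qn)"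
    and lim: "\<And>\<omega>. \<omega> \<in> space M \<Longrightarrow> (\<lambda>n. qn (f n \<omega> - h \<omega>)) \<longlonglongrightarrow> 0"
  shows "h \<in> measurable M (qn_borel qn)"
proof (rule measurable_qn_borelI)
  fix U assume U: "openin (qn_topology qn) U"
  define C where "C r = {x. \<exists>c\<in>-U. qn (x - c) < r}" for r
  have "C r = (\<Union>c\<in>-U. {x. qn (x - c) < r})" for r unfolding C_def by blast
  then have openC: "openin (qn_topology qn) (C r)" for r using openin_qn_ball by auto
  \<comment> \<open>This is the preimage of the closed set \<open>-U\<close> under \<open>h\<close>:
    for every m the sequence eventually stays in the m-th open neighbourhood of
    \<open>-U\<close>.\<close>
  define A where "A = (\<Inter>m. \<Union>N. \<Inter>n\<in>{N..}. {\<omega>\<in>space M. f n \<omega> \<in> C (1 / real (Suc m))})"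
  have "A \<in> sets M"
    unfolding A_def using measurable_qn_borelD[OF f openC] by (intro sets.countable_INT sets.countable_UN) auto
  moreover have "{\<omega>\<in>space M. h \<omega> \<in> U} = space M - A"
  proof (intro equalityI subsetI)
    fix \<omega> assume "\<omega> \<in> {\<omega>\<in>space M. h \<omega> \<in> U}"
    then have \<omega>: "\<omega> \<in> space M" "h \<omega> \<in> U" by auto
    obtain e where e: "e > 0" "\<And>z. qn (z - h \<omega>) \<le> e \<Longrightarrow> z \<in> U"
      using U \<omega>(2) unfolding openin_qn_topology by blast
    have r: "e / (2 * qconst) > 0" using e(1) qconst_pos by simp
    then obtain m where m: "1 / real (Suc m) < e / (2 * qconst)" using nat_approx_posE by blast
    have "\<omega> \<notin> A"
    proof
      assume "\<omega> \<in> A"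
      then have "\<omega> \<in> (\<Union>N. \<Inter>n\<in>{N..}. {\<omega>\<in>space M. f n \<omega> \<in> C (1 / real (Suc m))})"
        unfolding A_def by (rule INT_D) simp
      then obtain N where N: "\<And>n. n \<ge> N \<Longrightarrow> f n \<omega> \<in> C (1 / real (Suc m))" by auto
      have "eventually (\<lambda>n. qn (f n \<omega> - h \<omega>) < e / (2 * qconst)) sequentially"
        using lim[OF \<omega>(1)] r by (rule order_tendstoD)
      then obtain N' where N': "\<And>n. n \<ge> N' \<Longrightarrow> qn (f n \<omega> - h \<omega>) < e / (2 * qconst)"
        unfolding eventually_sequentially by blast
      define n where "n = max N N'"
      obtain c where c: "c \<notin> U" "qn (f n \<omega> - c) < 1 / real (Suc m)" using N[of n] by (auto simp: C_def n_def)
      have "qn (c - h \<omega>) \<le> qconst * (e / (2 * qconst) + e / (2 * qconst))"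
        using c(2) m N'[of n] qn_minus_commute[of c "f n \<omega>"]
        by (intro qn_diff_le_mono[of _ "f n \<omega>"]) (auto simp: n_def)
      also have "\<dots> = e" using qconst_pos by (simp add: field_simps)
      finally show False using e(2) c(1) by blast
    qed
    then show "\<omega> \<in> space M - A" using \<omega>(1) by blast
  next
    fix \<omega> assume \<omega>: "\<omega> \<in> space M - A"
    have "\<omega> \<in> A" if h: "h \<omega> \<notin> U"
      unfolding A_def
    proof (intro INT_I)
      fix m :: nat
      have "eventually (\<lambda>n. qn (f n \<omega> - h \<omega>) < 1 / real (Suc m)) sequentially"
        using lim[of \<omega>] \<omega> by (intro order_tendstoD) auto
      then obtain N where "\<And>n. n \<ge> N \<Longrightarrow> qn (f n \<omega> - h \<omega>) < 1 / real (Suc m)"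
        unfolding eventually_sequentially by blast
      then show "\<omega> \<in> (\<Union>N. \<Inter>n\<in>{N..}. {\<omega>\<in>space M. f n \<omega> \<in> C (1 / real (Suc m))})"
        using h \<omega> by (auto simp: C_def intro!: exI[of _ N])
    qed
    then show "\<omega> \<in> {\<omega>\<in>space M. h \<omega> \<in> U}" using \<omega> by blast
  qed
  ultimately show "{\<omega>\<in>space M. h \<omega> \<in> U} \<in> sets M" by simp
qed

text \<open>A union of subspaces is not a subspace in general. The partial sums \<open>W n\<close>
  of the given subspaces increase, so their union is one, and separability passes through finite
  sums and countable unions.\<close>

lemma subspace_separable_sequence:
  assumes "\<And>n::nat. subspace (Y n)" "\<And>n. qn_separable (Y n)"
  shows "\<exists>Z. subspace Z \<and> qn_separable Z \<and> (\<forall>n. Y n \<subseteq> Z)"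
proof -
  define W where "W = rec_nat (Y 0) (\<lambda>n S. {x + y | x y. x \<in> S \<and> y \<in> Y (Suc n)})"
  have W: "W 0 = Y 0" "\<And>n. W (Suc n) = {x + y | x y. x \<in> W n \<and> y \<in> Y (Suc n)}"
    by (simp_all add: W_def)
  have sub: "subspace (W n)" for n
    by (induction n) (simp_all add: W assms subspace_sums)
  have sep: "qn_separable (W n)" for n
    by (induction n) (simp_all add: W assms qn_separable_sums)
  have "W n \<subseteq> W (Suc n)" for n
  proof
    fix x assume x: "x \<in> W n"
    have "0 \<in> Y (Suc n)" using assms(1) subspace_0 by blast
    then show "x \<in> W (Suc n)" using x unfolding W(2) by force
  qed
  then have mono: "W m \<subseteq> W n" if "m \<le> n" for m n using that lift_Suc_mono_le[of W] by blast
  have YW: "Y n \<subseteq> W n" for n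
  proof (cases n)
    case (Suc k)
    have "0 \<in> W k" using sub subspace_0 by blast
    then show ?thesis unfolding Suc W(2) by force
  qed (simp add: W)
  have "subspace (\<Union>n. W n)"
  proof (rule subspaceI)
    show "0 \<in> (\<Union>n. W n)" using sub subspace_0 by blast
  next
    fix x y assume "x \<in> (\<Union>n. W n)" "y \<in> (\<Union>n. W n)"
    then obtain m n where "x \<in> W m" "y \<in> W n" by blast
    then have "x \<in> W (max m n)" "y \<in> W (max m n)" using mono by (meson max.cobounded1 max.cobounded2 subsetD)+
    then show "x + y \<in> (\<Union>n. W n)" using subspace_add[OF sub] by blast
  next
    fix c x assume "x \<in> (\<Union>n. W n)"
    then show "smul c x \<in> (\<Union>n. W n)" using subspace_scale[OF sub] by blast
  qed
  moreover have "qn_separable (\<Union>n. W n)" using sep by (rule qn_separable_UN)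
  ultimately show ?thesis using YW by blast
qed

text \<open>One null set collects the points where convergence fails or where some
  \<open>f n\<close> leaves a common separable subspace \<open>Z\<close>. Off it the limit exists
  and lies in the closure of \<open>Z\<close>.\<close>

lemma strongly_measurable_limit:
  assumes f: "\<And>n::nat. f n \<in> strongly_measurable M smul qn"
    and conv: "AE \<omega> in M. \<exists>l. (\<lambda>n. qn (f n \<omega> - l)) \<longlonglongrightarrow> 0"
  shows "\<exists>h\<in>strongly_measurable M smul qn. AE \<omega> in M. (\<lambda>n. qn (f n \<omega> - h \<omega>)) \<longlonglongrightarrow> 0"
proof -
  have fm: "f n \<in> measurable M (qn_borel qn)" for n
    using f[of n] unfolding strongly_measurable_iff by blast
  obtain Y where Y: "\<And>n. subspace (Y n)" "\<And>n. qn_separable (Y n)" "\<And>n. AE \<omega> in M. f n \<omega> \<in> Y n"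
    using f unfolding strongly_measurable_iff by metis
  obtain Z where Z: "subspace Z" "qn_separable Z" "\<And>n. Y n \<subseteq> Z"
    using subspace_separable_sequence[of Y, OF Y(1,2)] by blast
  have "AE \<omega> in M. \<forall>n. f n \<omega> \<in> Y n" using Y(3) by (simp add: AE_all_countable)
  then have "AE \<omega> in M. (\<forall>n. f n \<omega> \<in> Z) \<and> (\<exists>l. (\<lambda>n. qn (f n \<omega> - l)) \<longlonglongrightarrow> 0)"
    using conv by eventually_elim (use Z(3) in blast)
  then obtain N where N: "N \<in> null_sets M"
    "\<And>\<omega>. \<omega> \<in> space M - N \<Longrightarrow> (\<forall>n. f n \<omega> \<in> Z) \<and> (\<exists>l. (\<lambda>n. qn (f n \<omega> - l)) \<longlonglongrightarrow> 0)"
    by (rule AE_E3) blast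
  \<comment> \<open>Both the functions and the limit are 0 on \<open>N\<close>, so convergence holds
    at every point, as the measurability of limits demands.\<close>
  define g where "g n \<omega> = (if \<omega> \<in> N then 0 else f n \<omega>)" for n \<omega>
  define h where "h \<omega> = (if \<omega> \<in> N then 0 else SOME l. (\<lambda>n. qn (f n \<omega> - l)) \<longlonglongrightarrow> 0)" for \<omega>
  have g: "g n \<in> measurable M (qn_borel qn)" for n
    unfolding g_def using measurable_zero_on[OF fm] N(1) by (auto simp: null_sets_def)
  have gZ: "g n \<omega> \<in> Z" if "\<omega> \<in> space M" for n \<omega>
    using N(2)[of \<omega>] that subspace_0[OF Z(1)] by (auto simp: g_def)
  have lim: "(\<lambda>n. qn (g n \<omega> - h \<omega>)) \<longlonglongrightarrow> 0" if "\<omega> \<in> space M" for \<omega>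
  proof (cases "\<omega> \<in> N")
    case False
    then have "\<exists>l. (\<lambda>n. qn (f n \<omega> - l)) \<longlonglongrightarrow> 0" using N(2) that by blast
    from someI_ex[OF this] False show ?thesis by (simp add: g_def h_def)
  qed (simp add: g_def h_def)
  have "h \<in> measurable M (qn_borel qn)" using g lim by (rule measurable_qn_borel_limit)
  moreover have "h \<omega> \<in> qn_closure Z" if \<omega>: "\<omega> \<in> space M" for \<omega>
    unfolding qn_closure_def
  proof (intro CollectI allI impI)
    fix e :: real assume "e > 0"
    with lim[OF \<omega>] have "eventually (\<lambda>n. qn (g n \<omega> - h \<omega>) < e) sequentially" by (rule order_tendstoD)
    then obtain n where "qn (g n \<omega> - h \<omega>) < e" unfolding eventually_sequentially by blast
    then show "\<exists>z\<in>Z. qn (h \<omega> - z) < e" using gZ[OF \<omega>, of n] qn_minus_commute[of "h \<omega>" "g n \<omega>"]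
      by (intro bexI[of _ "g n \<omega>"]) simp_all
  qed
  ultimately have "h \<in> strongly_measurable M smul qn"
    unfolding strongly_measurable_iff
    using subspace_qn_closure[OF Z(1)] qn_separable_closure[OF Z(2)] by (blast intro: AE_I2)
  moreover have "AE \<omega> in M. (\<lambda>n. qn (f n \<omega> - h \<omega>)) \<longlonglongrightarrow> 0"
    using AE_not_in[OF N(1)] AE_space
  proof eventually_elim
    case (elim \<omega>)
    then show ?case using lim[of \<omega>] by (simp add: g_def)
  qed
  ultimately show ?thesis by blast
qed

end

section \<open>Classes of strongly measurable functions\<close>

locale measurable_classes = continuous_quasi_norm smul qn
  for smul :: "'k::real_normed_field \<Rightarrow> 'x::ab_group_add \<Rightarrow> 'x" and qn :: "'x \<Rightarrow> real" +
  fixes M :: "'a measure"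
begin

abbreviation SM :: "('a \<Rightarrow> 'x) set" where "SM \<equiv> strongly_measurable M smul qn"
abbreviation L :: "('a \<Rightarrow> 'x) set set" where "L \<equiv> L_space M smul qn"
abbreviation plus_L (infixl "\<oplus>" 65) where "A \<oplus> B \<equiv> L_add M smul qn A B"
abbreviation scale_L (infixr "\<odot>" 75) where "c \<odot> A \<equiv> L_scale M smul qn c A"
abbreviation zero_L ("\<zero>") where "\<zero> \<equiv> L_zero M smul qn"

definition cls :: "('a \<Rightarrow> 'x) \<Rightarrow> ('a \<Rightarrow> 'x) set" where
  "cls f = {g \<in> SM. AE \<omega> in M. f \<omega> = g \<omega>}"

text \<open>Classes are handled through one chosen representative; an identity between classes then
  becomes an almost-everywhere identity between functions, by \<open>L_eqI\<close>.\<close>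

definition rep :: "('a \<Rightarrow> 'x) set \<Rightarrow> 'a \<Rightarrow> 'x" where
  "rep A = (SOME f. f \<in> A)"

section \<open>Quotient by almost-everywhere equality and its vector space structure\<close>

lemma L_eq_cls: "L = cls ` SM"
proof -
  have "{(f, g). f \<in> SM \<and> g \<in> SM \<and> (AE \<omega> in M. f \<omega> = g \<omega>)} `` {f} = cls f" if "f \<in> SM" for f
    using that by (auto simp: cls_def)
  then show ?thesis unfolding L_space_def quotient_def by auto
qed

lemma cls_in_L: "f \<in> SM \<Longrightarrow> cls f \<in> L"
  unfolding L_eq_cls by blast

lemma L_subset_SM: "A \<in> L \<Longrightarrow> A \<subseteq> SM"
  unfolding L_eq_cls cls_def by blast

lemma rep_in:
  assumes "A \<in> L"
  shows "rep A \<in> A" "rep A \<in> SM"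
proof -
  obtain f where "f \<in> SM" "A = cls f" using assms unfolding L_eq_cls by blast
  then have "f \<in> A" by (simp add: cls_def)
  then show "rep A \<in> A" unfolding rep_def by (rule someI[of "\<lambda>f. f \<in> A"])
  then show "rep A \<in> SM" using L_subset_SM[OF assms] by blast
qed

lemma AE_eq_members:
  assumes "A \<in> L" "f \<in> A" "g \<in> A"
  shows "AE \<omega> in M. f \<omega> = g \<omega>"
proof -
  obtain h where "A = cls h" using assms(1) unfolding L_eq_cls by blast
  then have "AE \<omega> in M. h \<omega> = f \<omega>" "AE \<omega> in M. h \<omega> = g \<omega>" using assms by (auto simp: cls_def)
  then show ?thesis by eventually_elim simp
qed

lemma cls_cong:
  assumes "AE \<omega> in M. f \<omega> = g \<omega>"
  shows "cls f = cls g"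
proof -
  have "(AE \<omega> in M. f \<omega> = h \<omega>) \<longleftrightarrow> (AE \<omega> in M. g \<omega> = h \<omega>)" for h
  proof
    assume "AE \<omega> in M. f \<omega> = h \<omega>"
    with assms show "AE \<omega> in M. g \<omega> = h \<omega>" by eventually_elim simp
  next
    assume "AE \<omega> in M. g \<omega> = h \<omega>"
    with assms show "AE \<omega> in M. f \<omega> = h \<omega>" by eventually_elim simp
  qed
  then show ?thesis by (simp add: cls_def)
qed

lemma cls_rep:
  assumes "A \<in> L"
  shows "cls (rep A) = A"
proof -
  obtain h where h: "A = cls h" using assms unfolding L_eq_cls by blast
  then have "AE \<omega> in M. h \<omega> = rep A \<omega>" using rep_in(1)[OF assms] by (simp add: cls_def)
  then show ?thesis using cls_cong h by metis
qed

lemma rep_cls: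
  assumes "f \<in> SM"
  shows "AE \<omega> in M. rep (cls f) \<omega> = f \<omega>"
proof -
  have "f \<in> cls f" using assms by (simp add: cls_def)
  then show ?thesis using AE_eq_members[OF cls_in_L[OF assms]] rep_in(1)[OF cls_in_L[OF assms]] by blast
qed

lemma L_eqI:
  assumes "A \<in> L" "B \<in> L" "AE \<omega> in M. rep A \<omega> = rep B \<omega>"
  shows "A = B"
  using cls_cong[OF assms(3)] cls_rep assms(1,2) by simp

text \<open>\<open>strongly_measurable_add\<close> supplies a member of the sum. Without one the
  defining set would be empty; with one it is exactly the class of that member, because
  representatives differ only on null sets.\<close>

lemma L_add_in:
  assumes "A \<in> L" "B \<in> L"
  shows "A \<oplus> B \<in> L" and "AE \<omega> in M. rep (A \<oplus> B) \<omega> = rep A \<omega> + rep B \<omega>"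
proof -
  obtain h where h: "h \<in> SM" "AE \<omega> in M. h \<omega> = rep A \<omega> + rep B \<omega>"
    using strongly_measurable_add rep_in(2) assms by blast
  have "A \<oplus> B = cls h"
  proof (intro equalityI subsetI)
    fix g assume "g \<in> A \<oplus> B"
    then obtain f f' where g: "g \<in> SM" "f \<in> A" "f' \<in> B" "AE \<omega> in M. g \<omega> = f \<omega> + f' \<omega>"
      unfolding L_add_def by blast
    have "AE \<omega> in M. h \<omega> = g \<omega>"
      using g(4) h(2) AE_eq_members[OF assms(1) g(2) rep_in(1)[OF assms(1)]]
        AE_eq_members[OF assms(2) g(3) rep_in(1)[OF assms(2)]]
      by eventually_elim simp
    then show "g \<in> cls h" using g(1) by (simp add: cls_def)
  next
    fix g assume "g \<in> cls h"
    then have g: "g \<in> SM" "AE \<omega> in M. h \<omega> = g \<omega>" by (auto simp: cls_def)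
    from g(2) h(2) have "AE \<omega> in M. g \<omega> = rep A \<omega> + rep B \<omega>" by eventually_elim simp
    then show "g \<in> A \<oplus> B" unfolding L_add_def using g(1) rep_in(1) assms by blast
  qed
  then show "A \<oplus> B \<in> L" "AE \<omega> in M. rep (A \<oplus> B) \<omega> = rep A \<omega> + rep B \<omega>"
    using cls_in_L[OF h(1)] rep_cls[OF h(1)] h(2) by auto
qed

lemma L_scale_in:
  assumes "A \<in> L"
  shows "c \<odot> A \<in> L" and "AE \<omega> in M. rep (c \<odot> A) \<omega> = smul c (rep A \<omega>)"
proof -
  let ?h = "\<lambda>\<omega>. smul c (rep A \<omega>)"
  have h: "?h \<in> SM" using strongly_measurable_scale rep_in(2) assms by blast
  have "c \<odot> A = cls ?h"
  proof (intro equalityI subsetI)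
    fix g assume "g \<in> c \<odot> A"
    then obtain f where g: "g \<in> SM" "f \<in> A" "AE \<omega> in M. g \<omega> = smul c (f \<omega>)"
      unfolding L_scale_def by blast
    have "AE \<omega> in M. ?h \<omega> = g \<omega>"
      using g(3) AE_eq_members[OF assms g(2) rep_in(1)[OF assms]] by eventually_elim simp
    then show "g \<in> cls ?h" using g(1) by (simp add: cls_def)
  next
    fix g assume "g \<in> cls ?h"
    then have g: "g \<in> SM" "AE \<omega> in M. ?h \<omega> = g \<omega>" by (auto simp: cls_def)
    from g(2) have "AE \<omega> in M. g \<omega> = smul c (rep A \<omega>)" by eventually_elim simp
    then show "g \<in> c \<odot> A" unfolding L_scale_def using g(1) rep_in(1)[OF assms] by blast
  qed
  then show "c \<odot> A \<in> L" "AE \<omega> in M. rep (c \<odot> A) \<omega> = smul c (rep A \<omega>)"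
    using cls_in_L[OF h] rep_cls[OF h] by auto
qed

lemma L_zero_in: "\<zero> \<in> L" "AE \<omega> in M. rep \<zero> \<omega> = 0"
proof -
  have "\<zero> = cls (\<lambda>\<omega>. 0)"
    unfolding L_zero_def cls_def by (auto elim: eventually_mono)
  then show "\<zero> \<in> L" "AE \<omega> in M. rep \<zero> \<omega> = 0"
    using cls_in_L[OF strongly_measurable_zero] rep_cls[OF strongly_measurable_zero] by simp_all
qed

lemma vector_space_on_L: "vector_space_on L (L_add M smul qn) \<zero> (L_scale M smul qn)"
proof
  fix A B C :: "('a \<Rightarrow> 'x) set" and a b :: 'k
  show "\<zero> \<in> L" by (rule L_zero_in)
  assume A: "A \<in> L"
  show cA: "a \<odot> A \<in> L" for a by (rule L_scale_in(1)[OF A])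
  note sA = L_scale_in(2)[OF A]
  have "AE \<omega> in M. rep (A \<oplus> \<zero>) \<omega> = rep (A) \<omega>"
    using L_add_in(2)[OF A L_zero_in(1)] L_zero_in(2)
    by eventually_elim (simp)
  then show "A \<oplus> \<zero> = A"
    by (intro L_eqI L_add_in(1) A L_zero_in)
  have "AE \<omega> in M. rep (A \<oplus> (-1) \<odot> A) \<omega> = rep (\<zero>) \<omega>"
    using L_add_in(2)[OF A cA, of "-1"] L_zero_in(2) sA[of "-1"]
    by eventually_elim (simp)
  then show "A \<oplus> (-1) \<odot> A = \<zero>"
    by (intro L_eqI L_add_in(1) A cA L_zero_in)
  have "AE \<omega> in M. rep ((a + b) \<odot> A) \<omega> = rep (a \<odot> A \<oplus> b \<odot> A) \<omega>"
    using L_add_in(2)[OF cA cA, of a b] sA[of a] sA[of b] sA[of "a + b"]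
    by eventually_elim (simp add: scale_left_distrib)
  then show "(a + b) \<odot> A = a \<odot> A \<oplus> b \<odot> A"
    by (intro L_eqI L_add_in(1) cA)
  have "AE \<omega> in M. rep (a \<odot> (b \<odot> A)) \<omega> = rep ((a * b) \<odot> A) \<omega>"
    using L_scale_in(2)[OF cA, of a b] sA[of b] sA[of "a * b"]
    by eventually_elim (simp)
  then show "a \<odot> (b \<odot> A) = (a * b) \<odot> A"
    by (intro L_eqI L_scale_in(1) cA A)
  have "AE \<omega> in M. rep (1 \<odot> A) \<omega> = rep (A) \<omega>"
    using sA[of 1]
    by eventually_elim (simp)
  then show "1 \<odot> A = A"
    by (intro L_eqI cA A)
  assume B: "B \<in> L"
  show AB: "A \<oplus> B \<in> L" by (rule L_add_in(1)[OF A B])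
  note sAB = L_add_in(2)[OF A B]
  have "AE \<omega> in M. rep (A \<oplus> B) \<omega> = rep (B \<oplus> A) \<omega>"
    using sAB L_add_in(2)[OF B A]
    by eventually_elim (simp add: add.commute)
  then show "A \<oplus> B = B \<oplus> A"
    by (intro L_eqI L_add_in(1) A B)
  have "AE \<omega> in M. rep (a \<odot> (A \<oplus> B)) \<omega> = rep (a \<odot> A \<oplus> a \<odot> B) \<omega>"
    using sAB L_scale_in(2)[OF AB, of a] sA[of a] L_scale_in(2)[OF B, of a] L_add_in(2)[OF cA L_scale_in(1)[OF B], of a a]
    by eventually_elim (simp add: scale_right_distrib)
  then show "a \<odot> (A \<oplus> B) = a \<odot> A \<oplus> a \<odot> B"
    by (intro L_eqI L_add_in(1) L_scale_in(1) A B)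
  assume C: "C \<in> L"
  have "AE \<omega> in M. rep (A \<oplus> B \<oplus> C) \<omega> = rep (A \<oplus> (B \<oplus> C)) \<omega>"
    using sAB L_add_in(2)[OF B C] L_add_in(2)[OF AB C] L_add_in(2)[OF A L_add_in(1)[OF B C]]
    by eventually_elim (simp add: add.assoc)
  then show "A \<oplus> B \<oplus> C = A \<oplus> (B \<oplus> C)"
    by (intro L_eqI L_add_in(1) A B C)
qed

text \<open>The distribution function of \<open>qn\<close> composed with \<open>f\<close>,
  restricted to \<open>E\<close>.\<close>

definition level :: "'a set \<Rightarrow> ('a \<Rightarrow> 'x) \<Rightarrow> real \<Rightarrow> ennreal" where
  "level E f t = emeasure M (E \<inter> superlevel M qn f t)"

lemma superlevel_sets:
  assumes "f \<in> SM"
  shows "superlevel M qn f t \<in> sets M"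
proof -
  have "f \<in> measurable M (qn_borel qn)" using assms unfolding strongly_measurable_iff by blast
  then have [measurable]: "(\<lambda>\<omega>. qn (f \<omega>)) \<in> borel_measurable M" by (rule borel_measurable_qn)
  show ?thesis unfolding superlevel_def by measurable
qed

lemma level_le:
  assumes "f \<in> SM" "E' \<in> sets M"
    and "AE \<omega> in M. \<omega> \<in> E \<longrightarrow> qn (g \<omega>) > t \<longrightarrow> \<omega> \<in> E' \<and> qn (f \<omega>) > s"
  shows "level E g t \<le> level E' f s"
  unfolding level_def
proof (rule emeasure_mono_AE)
  show "E' \<inter> superlevel M qn f s \<in> sets M" using assms superlevel_sets by blast
  show "AE \<omega> in M. \<omega> \<in> E \<inter> superlevel M qn g t \<longrightarrow> \<omega> \<in> E' \<inter> superlevel M qn f s"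
    using assms(3) by eventually_elim (simp add: superlevel_def)
qed

lemma level_cong:
  assumes "f \<in> SM" "g \<in> SM" "E \<in> sets M" "AE \<omega> in M. f \<omega> = g \<omega>"
  shows "level E f t = level E g t"
  by (rule antisym; rule level_le)
    (use assms in \<open>auto elim!: eventually_mono\<close>)

text \<open>Where f is at most s and g at most t in quasi-norm, the sum is at most
  \<open>qconst * (s + t)\<close>; hence its superlevel set is covered, up to a null set, by the two
  others.\<close>

lemma level_add:
  assumes "f \<in> SM" "g \<in> SM" "E \<in> sets M"
    and "AE \<omega> in M. h \<omega> = f \<omega> + g \<omega>"
  shows "level E h (qconst * (s + t)) \<le> level E f s + level E g t"
proof -
  have S: "E \<inter> superlevel M qn f s \<in> sets M" "E \<inter> superlevel M qn g t \<in> sets M"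
    using assms superlevel_sets by blast+
  have "level E h (qconst * (s + t))
      \<le> emeasure M ((E \<inter> superlevel M qn f s) \<union> (E \<inter> superlevel M qn g t))"
    unfolding level_def
  proof (rule emeasure_mono_AE)
    show "AE \<omega> in M. \<omega> \<in> E \<inter> superlevel M qn h (qconst * (s + t))
        \<longrightarrow> \<omega> \<in> E \<inter> superlevel M qn f s \<union> E \<inter> superlevel M qn g t"
      using assms(4)
    proof eventually_elim
      case (elim \<omega>)
      then show ?case using qn_add_le_mono[of "f \<omega>" s "g \<omega>" t]
        by (cases "qn (f \<omega>) \<le> s"; cases "qn (g \<omega>) \<le> t") (auto simp: superlevel_def)
    qed
  qed (use S in blast)
  also have "\<dots> \<le> level E f s + level E g t"
    unfolding level_def using S by (rule emeasure_subadditive)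
  finally show ?thesis .
qed

text \<open>The product form \<open>norm c * s \<le> t\<close>, in place of the quotient of t by
  \<open>norm c\<close>, includes c = 0.\<close>

lemma level_scale:
  assumes "f \<in> SM" "E \<in> sets M" "AE \<omega> in M. h \<omega> = smul c (f \<omega>)" "norm c * s \<le> t" "0 \<le> t"
  shows "level E h t \<le> level E f s"
  using assms(1,2)
proof (rule level_le)
  show "AE \<omega> in M. \<omega> \<in> E \<longrightarrow> t < qn (h \<omega>) \<longrightarrow> \<omega> \<in> E \<and> s < qn (f \<omega>)"
    using assms(3)
  proof eventually_elim
    case (elim \<omega>)
    have "s < qn (f \<omega>)" if "t < norm c * qn (f \<omega>)"
    proof (rule ccontr)
      assume "\<not> s < qn (f \<omega>)"
      then have "norm c * qn (f \<omega>) \<le> norm c * s" by (intro mult_left_mono) auto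
      then show False using that assms(4) by linarith
    qed
    then show ?case using elim qn_scale by auto
  qed
qed

lemma level_rep:
  assumes "A \<in> L" "f \<in> A" "E \<in> sets M"
  shows "level E f t = level E (rep A) t"
  using assms(3) AE_eq_members[OF assms(1,2) rep_in(1)[OF assms(1)]]
    L_subset_SM[OF assms(1)] assms(2) rep_in(2)[OF assms(1)]
  by (intro level_cong) auto

lemma V_set_iff:
  assumes "E \<in> sets M"
  shows "A \<in> V_set M smul qn E \<delta> t \<longleftrightarrow> A \<in> L \<and> level E (rep A) t < ennreal \<delta>"
proof -
  have "(\<exists>f\<in>A. level E f t < ennreal \<delta>) \<longleftrightarrow> level E (rep A) t < ennreal \<delta>" if "A \<in> L"
  proof
    assume "\<exists>f\<in>A. level E f t < ennreal \<delta>"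
    then obtain f where "f \<in> A" "level E f t < ennreal \<delta>" by blast
    then show "level E (rep A) t < ennreal \<delta>" using level_rep[OF that _ assms] by simp
  qed (use rep_in(1)[OF that] in blast)
  then show ?thesis unfolding V_set_def level_def[symmetric] by auto
qed

lemma L_on_iff:
  assumes "E \<in> sets M"
  shows "A \<in> L_on M smul qn E \<longleftrightarrow> A \<in> L \<and> (\<exists>t>0. level E (rep A) t < \<infinity>)"
proof -
  have "(\<exists>f\<in>A. \<exists>t>0. level E f t < \<infinity>) \<longleftrightarrow> (\<exists>t>0. level E (rep A) t < \<infinity>)" if "A \<in> L"
  proof
    assume "\<exists>f\<in>A. \<exists>t>0. level E f t < \<infinity>"
    then obtain f t where "f \<in> A" "t > 0" "level E f t < \<infinity>" by blast
    then show "\<exists>t>0. level E (rep A) t < \<infinity>"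
      using level_rep[OF that _ assms] by (intro exI[of _ t]) simp
  qed (use rep_in(1)[OF that] in blast)
  then show ?thesis unfolding L_on_def level_def[symmetric] by auto
qed

text \<open>Continuity of the measure from above, available because some level set has finite measure.\<close>

lemma level_small:
  assumes f: "f \<in> SM" and E: "E \<in> sets M" and fin: "level E f t < \<infinity>" and \<delta>: "0 < \<delta>"
  shows "\<exists>s>0. level E f s < ennreal \<delta>"
proof -
  \<comment> \<open>These thresholds are positive and lie above t, so every \<open>A n\<close> has
    finite measure.\<close>
  define A where "A n = E \<inter> superlevel M qn f (\<bar>t\<bar> + 1 + real n)" for n
  have A: "A n \<in> sets M" for n unfolding A_def using E superlevel_sets[OF f] by blast
  have "emeasure M (A n) \<noteq> \<infinity>" for n
  proof -
    have "emeasure M (A n) \<le> level E f t"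
      unfolding A_def level_def[symmetric] by (rule level_le[OF f E]) auto
    then show ?thesis using fin by (auto simp: top_unique)
  qed
  moreover have "decseq A" by (rule decseq_SucI) (auto simp: A_def superlevel_def)
  ultimately have "(\<lambda>n. emeasure M (A n)) \<longlonglongrightarrow> emeasure M (\<Inter>n. A n)"
    using A by (intro Lim_emeasure_decseq) auto
  moreover have "(\<Inter>n. A n) = {}"
  proof -
    have "\<omega> \<notin> A (nat \<lceil>qn (f \<omega>)\<rceil>)" for \<omega>
    proof -
      have "\<not> \<bar>t\<bar> + 1 + real (nat \<lceil>qn (f \<omega>)\<rceil>) < qn (f \<omega>)"
        using real_nat_ceiling_ge[of "qn (f \<omega>)"] by linarith
      then show ?thesis by (simp add: A_def superlevel_def)
    qed
    then show ?thesis by blast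
  qed
  ultimately have "(\<lambda>n. emeasure M (A n)) \<longlonglongrightarrow> 0" by simp
  then have "eventually (\<lambda>n. emeasure M (A n) < ennreal \<delta>) sequentially"
    using \<delta> by (intro order_tendstoD) auto
  then obtain n where "emeasure M (A n) < ennreal \<delta>" unfolding eventually_sequentially by blast
  then show ?thesis unfolding A_def level_def by (intro exI[of _ "\<bar>t\<bar> + 1 + real n"]) auto
qed

definition minus_L :: "('a \<Rightarrow> 'x) set \<Rightarrow> ('a \<Rightarrow> 'x) set \<Rightarrow> ('a \<Rightarrow> 'x) set" where
  "minus_L A B = A \<oplus> (-1) \<odot> B"

lemma minus_L_in:
  assumes "A \<in> L" "B \<in> L"
  shows "minus_L A B \<in> L" and "AE \<omega> in M. rep (minus_L A B) \<omega> = rep A \<omega> - rep B \<omega>"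
proof -
  show "minus_L A B \<in> L" unfolding minus_L_def using assms L_add_in(1) L_scale_in(1) by blast
  show "AE \<omega> in M. rep (minus_L A B) \<omega> = rep A \<omega> - rep B \<omega>"
    unfolding minus_L_def
    using L_add_in(2)[OF assms(1) L_scale_in(1)[OF assms(2)], of "-1"] L_scale_in(2)[OF assms(2), of "-1"]
    by eventually_elim simp
qed

lemma level_minus_triangle:
  assumes "A \<in> L" "B \<in> L" "C \<in> L" "E \<in> sets M"
  shows "level E (rep (minus_L A C)) (qconst * (s + t))
    \<le> level E (rep (minus_L A B)) s + level E (rep (minus_L B C)) t"
proof (rule level_add)
  show "AE \<omega> in M. rep (minus_L A C) \<omega> = rep (minus_L A B) \<omega> + rep (minus_L B C) \<omega>"
    using minus_L_in(2)[OF assms(1,2)] minus_L_in(2)[OF assms(2,3)] minus_L_in(2)[OF assms(1,3)]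
    by eventually_elim simp
qed (use assms minus_L_in(1) rep_in(2) in auto)

lemma level_mono:
  assumes "A \<in> L" "E' \<in> sets M" "E \<subseteq> E'" "s \<le> t"
  shows "level E (rep A) t \<le> level E' (rep A) s"
  using rep_in(2)[OF assms(1)] assms(2) by (rule level_le) (use assms in auto)

text \<open>Continuity from below along \<open>E \<inter> D m\<close>. It holds for sets of infinite
  measure too, so a bound uniform in m passes to \<open>E\<close> even if nothing is known there
  yet.\<close>

lemma level_le_exhaustion:
  assumes A: "A \<in> L" and E: "E \<in> sets M" and D: "\<And>m::nat. D m \<in> sets M" "incseq D"
    and cover: "AE \<omega> in M. \<omega> \<in> (\<Union>m. D m)"
    and le: "\<And>m. level (E \<inter> D m) (rep A) t \<le> c"
  shows "level E (rep A) t \<le> c"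
proof -
  define S where "S = superlevel M qn (rep A) t"
  have S: "S \<in> sets M" unfolding S_def using superlevel_sets rep_in(2)[OF A] by blast
  define H where "H m = E \<inter> D m \<inter> S" for m
  have H: "H m \<in> sets M" for m unfolding H_def using E D(1) S by blast
  have "incseq H" using D(2) unfolding H_def incseq_def by blast
  then have lim: "(\<lambda>m. emeasure M (H m)) \<longlonglongrightarrow> emeasure M (\<Union>m. H m)"
    using H by (intro Lim_emeasure_incseq) auto
  have "emeasure M (E \<inter> S) \<le> emeasure M (\<Union>m. H m)"
  proof (rule emeasure_mono_AE)
    show "AE \<omega> in M. \<omega> \<in> E \<inter> S \<longrightarrow> \<omega> \<in> (\<Union>m. H m)"
      using cover by eventually_elim (auto simp: H_def)
  qed (use H in blast)
  moreover have "emeasure M (\<Union>m. H m) \<le> c"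
    using lim by (rule LIMSEQ_le_const2) (use le in \<open>auto simp: level_def H_def S_def\<close>)
  ultimately show ?thesis unfolding level_def S_def by simp
qed

end

section \<open>The neighbourhood base\<close>

locale directed_measurable_classes =
  measurable_classes smul qn M + quasi_banach_space smul qn
  for smul :: "'k::real_normed_field \<Rightarrow> 'x::ab_group_add \<Rightarrow> 'x" and qn :: "'x \<Rightarrow> real"
    and M :: "'a measure" +
  fixes F :: "'a set set"
  assumes F_nonempty: "F \<noteq> {}" and directed: "directed_to M F (space M)"
begin

lemma F_sets: "E \<in> F \<Longrightarrow> E \<in> sets M"
  using directed[unfolded directed_to_def, THEN conjunct1] by (rule subsetD)

lemma F_upper:
  assumes "E \<in> F" "E' \<in> F"
  shows "\<exists>D\<in>F. E \<subseteq> D \<and> E' \<subseteq> D"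
proof -
  have "\<forall>A\<in>F. \<forall>B\<in>F. \<exists>D\<in>F. A \<union> B \<subseteq> D" using directed unfolding directed_to_def by (elim conjE)
  then obtain D where "D \<in> F" "E \<union> E' \<subseteq> D" using assms by meson
  then show ?thesis by (intro bexI[of _ D]) simp_all
qed

text \<open>Directedness is applied recursively: \<open>D (n + 1)\<close> is chosen in
  \<open>F\<close> above both \<open>D n\<close> and the next member of an enumeration of the
  countable cover.\<close>

lemma exhausting_sequence:
  "\<exists>D :: nat \<Rightarrow> 'a set. (\<forall>n. D n \<in> F) \<and> incseq D \<and> (AE \<omega> in M. \<omega> \<in> (\<Union>n. D n))"
proof -
  obtain G where G: "G \<subseteq> F" "countable G" "emeasure M (space M - \<Union>G) = 0"
    using directed unfolding directed_to_def by (elim conjE exE)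
  obtain E0 where E0: "E0 \<in> F" using F_nonempty by blast
  \<comment> \<open>The cover \<open>G\<close> may be empty when the whole space is null; inserting
    \<open>E0\<close> guarantees a nonempty set to enumerate.\<close>
  define e where "e = from_nat_into (insert E0 G)"
  have e: "range e = insert E0 G" unfolding e_def using G(2) by simp
  have eF: "e n \<in> F" for n
  proof -
    have "e n \<in> insert E0 G" using rangeI[of e n] by (simp only: e)
    then show ?thesis using G(1) E0 by auto
  qed
  have "\<exists>D. \<forall>n. (D n \<in> F \<and> e n \<subseteq> D n) \<and> D n \<subseteq> D (Suc n)"
  proof (rule dependent_nat_choice)
    show "\<exists>X. X \<in> F \<and> e 0 \<subseteq> X" using eF by blast
  next
    fix X n assume "X \<in> F \<and> e n \<subseteq> X"
    then have X: "X \<in> F" by simp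
    show "\<exists>Y. (Y \<in> F \<and> e (Suc n) \<subseteq> Y) \<and> X \<subseteq> Y"
      using F_upper[OF X eF[of "Suc n"]] by blast
  qed
  then obtain D where D: "\<And>n. D n \<in> F" "\<And>n. e n \<subseteq> D n" "\<And>n. D n \<subseteq> D (Suc n)" by blast
  have "AE \<omega> in M. \<omega> \<in> \<Union>G"
  proof (rule AE_I)
    show "space M - \<Union>G \<in> sets M" using G F_sets by (intro sets.compl_sets sets.countable_Union) auto
  qed (use G(3) in auto)
  then have "AE \<omega> in M. \<omega> \<in> (\<Union>n. D n)"
  proof eventually_elim
    case (elim \<omega>)
    then obtain E where "\<omega> \<in> E" "E \<in> range e" using e by auto
    then obtain n where "\<omega> \<in> e n" by auto
    then show ?case using D(2)[of n] by auto
  qed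
  moreover have "incseq D" using D(3) by (intro incseq_SucI)
  ultimately show ?thesis using D(1) by (intro exI[of _ D]) simp
qed

section \<open>The subspace cut out by the family\<close>

abbreviation LF :: "('a \<Rightarrow> 'x) set set" where "LF \<equiv> L_family M smul qn F"

text \<open>Nonemptiness of \<open>F\<close> is what extracts \<open>A \<in> L\<close> from the
  intersection over \<open>F\<close>.\<close>

lemma LF_iff: "A \<in> LF \<longleftrightarrow> A \<in> L \<and> (\<forall>E\<in>F. \<exists>t>0. level E (rep A) t < \<infinity>)"
proof -
  have "A \<in> LF \<longleftrightarrow> (\<forall>E\<in>F. A \<in> L \<and> (\<exists>t>0. level E (rep A) t < \<infinity>))"
    unfolding L_family_def using L_on_iff[OF F_sets] by auto
  then show ?thesis using F_nonempty by blast
qed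

lemma LF_L: "A \<in> LF \<Longrightarrow> A \<in> L"
  by (simp add: LF_iff)

lemma level_finite_add:
  assumes "A \<in> L" "B \<in> L" "C \<in> L" "AE \<omega> in M. rep C \<omega> = rep A \<omega> + rep B \<omega>" "E \<in> sets M"
    and "0 < s" "level E (rep A) s < \<infinity>" "0 < t" "level E (rep B) t < \<infinity>"
  shows "\<exists>u>0. level E (rep C) u < \<infinity>"
proof -
  have "level E (rep C) (qconst * (s + t)) \<le> level E (rep A) s + level E (rep B) t"
    using assms by (intro level_add rep_in(2))
  also have "\<dots> < \<infinity>" using assms by (simp add: ennreal_add_eq_top less_top)
  finally show ?thesis using assms qconst_pos by (intro exI[of _ "qconst * (s + t)"]) simp
qed

lemma LF_add:
  assumes "A \<in> LF" "B \<in> LF"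
  shows "A \<oplus> B \<in> LF"
  unfolding LF_iff
proof (intro conjI ballI)
  have AB: "A \<in> L" "B \<in> L" using assms LF_L by auto
  show L: "A \<oplus> B \<in> L" using L_add_in(1)[OF AB] .
  fix E assume E: "E \<in> F"
  obtain s where s: "s > 0" "level E (rep A) s < \<infinity>" using assms(1) E LF_iff by blast
  obtain t where t: "t > 0" "level E (rep B) t < \<infinity>" using assms(2) E LF_iff by blast
  show "\<exists>t>0. level E (rep (A \<oplus> B)) t < \<infinity>"
    using AB L L_add_in(2)[OF AB] F_sets[OF E] s t by (rule level_finite_add)
qed

lemma LF_scale:
  assumes "A \<in> LF"
  shows "c \<odot> A \<in> LF"
  unfolding LF_iff
proof (intro conjI ballI)
  have A: "A \<in> L" using assms LF_L by auto
  show L: "c \<odot> A \<in> L" using L_scale_in(1)[OF A] .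
  fix E assume E: "E \<in> F"
  obtain s where s: "s > 0" "level E (rep A) s < \<infinity>" using assms(1) E LF_iff by blast
  have "level E (rep (c \<odot> A)) ((norm c + 1) * s) \<le> level E (rep A) s"
    using rep_in(2)[OF A] F_sets[OF E] L_scale_in(2)[OF A]
    by (rule level_scale) (use s(1) in \<open>auto simp: algebra_simps\<close>)
  also have "\<dots> < \<infinity>" by (rule s)
  finally show "\<exists>t>0. level E (rep (c \<odot> A)) t < \<infinity>"
    using s(1) by (intro exI[of _ "(norm c + 1) * s"]) (simp add: add_nonneg_pos)
qed

lemma LF_zero: "\<zero> \<in> LF"
  unfolding LF_iff
proof (intro conjI ballI)
  fix E
  have "emeasure M (E \<inter> superlevel M qn (rep \<zero>) 1) \<le> emeasure M {}"
    by (rule emeasure_mono_AE, use L_zero_in(2) in eventually_elim) (auto simp: superlevel_def)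
  then show "\<exists>t>0. level E (rep \<zero>) t < \<infinity>" by (intro exI[of _ 1]) (simp add: level_def)
qed (rule L_zero_in)

lemma LF_minus: "A \<in> LF \<Longrightarrow> B \<in> LF \<Longrightarrow> minus_L A B \<in> LF"
  unfolding minus_L_def by (intro LF_add LF_scale)

lemma vector_space_on_LF: "vector_space_on LF (L_add M smul qn) \<zero> (L_scale M smul qn)"
proof -
  interpret V: vector_space_on L "L_add M smul qn" \<zero> "L_scale M smul qn" by (rule vector_space_on_L)
  show ?thesis
    by unfold_locales
      (simp_all add: LF_zero LF_add LF_scale LF_L V.add_assoc V.add_zero V.add_inverse
        V.scale_add_right V.scale_add_left V.scale_scale V.scale_one, simp add: V.add_comm LF_L)
qed

section \<open>Verification of the neighbourhood axioms\<close>

definition VF :: "'a set \<Rightarrow> real \<Rightarrow> real \<Rightarrow> ('a \<Rightarrow> 'x) set set" where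
  "VF E \<delta> t = V_set M smul qn E \<delta> t \<inter> LF"

definition base :: "('a \<Rightarrow> 'x) set set set" where
  "base = {VF E \<delta> t | E \<delta> t. E \<in> F \<and> 0 < \<delta> \<and> 0 < t}"

lemma VF_iff: "E \<in> F \<Longrightarrow> A \<in> VF E \<delta> t \<longleftrightarrow> A \<in> LF \<and> level E (rep A) t < ennreal \<delta>"
  unfolding VF_def using V_set_iff[OF F_sets] LF_L by auto

lemma baseI: "E \<in> F \<Longrightarrow> 0 < \<delta> \<Longrightarrow> 0 < t \<Longrightarrow> VF E \<delta> t \<in> base"
  unfolding base_def by blast

text \<open>Such a class has null superlevel sets on each \<open>D m\<close> for each threshold
  1/(n+1). These are countably many null sets and the \<open>D m\<close> cover the space, so the
  representative vanishes almost everywhere. This gives the Hausdorff property.\<close>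

lemma L_zeroI:
  assumes A: "A \<in> L" and small: "\<And>E \<delta> t. E \<in> F \<Longrightarrow> 0 < \<delta> \<Longrightarrow> 0 < t \<Longrightarrow> level E (rep A) t < ennreal \<delta>"
  shows "A = \<zero>"
proof -
  obtain D :: "nat \<Rightarrow> 'a set" where D: "\<And>n. D n \<in> F" "incseq D" "AE \<omega> in M. \<omega> \<in> (\<Union>n. D n)"
    using exhausting_sequence by blast
  have "level E (rep A) t = 0" if "E \<in> F" "0 < t" for E t
  proof -
    have "level E (rep A) t \<le> 0"
      by (rule ennreal_le_epsilon) (use small[OF that(1) _ that(2)] in \<open>auto intro: less_imp_le\<close>)
    then show ?thesis by simp
  qed
  then have "D m \<inter> superlevel M qn (rep A) (1 / real (Suc n)) \<in> null_sets M" for m n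
    using F_sets[OF D(1)] superlevel_sets[OF rep_in(2)[OF A]] D(1)
    by (intro null_setsI) (auto simp: level_def)
  then have "AE \<omega> in M. \<forall>m n. \<omega> \<notin> D m \<inter> superlevel M qn (rep A) (1 / real (Suc n))"
    unfolding AE_all_countable using AE_not_in by blast
  then have "AE \<omega> in M. rep A \<omega> = rep \<zero> \<omega>"
    using D(3) AE_space L_zero_in(2)
  proof eventually_elim
    case (elim \<omega>)
    then obtain m where "\<omega> \<in> D m" by blast
    then have "\<And>n. \<not> qn (rep A \<omega>) > 1 / real (Suc n)" using elim by (auto simp: superlevel_def)
    then have "\<not> 0 < qn (rep A \<omega>)" using nat_approx_posE by metis
    then show ?case using elim qn_pos by metis
  qed
  then show ?thesis by (rule L_eqI[OF A L_zero_in(1)])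
qed

lemma neighbourhood_base: "tvs_neighbourhood_base LF (L_add M smul qn) \<zero> (L_scale M smul qn) base"
proof (intro tvs_neighbourhood_base.intro vector_space_on_LF tvs_neighbourhood_base_axioms.intro)
  show "base \<noteq> {}" using F_nonempty baseI zero_less_one by blast
next
  show "U \<subseteq> LF" if "U \<in> base" for U using that unfolding base_def VF_def by blast
next
  fix U U' assume "U \<in> base" "U' \<in> base"
  then obtain E \<delta> t E' \<delta>' t' where U: "U = VF E \<delta> t" "E \<in> F" "0 < \<delta>" "0 < t"
    "U' = VF E' \<delta>' t'" "E' \<in> F" "0 < \<delta>'" "0 < t'" unfolding base_def by blast
  obtain D where D: "D \<in> F" "E \<subseteq> D" "E' \<subseteq> D" using F_upper U by blast
  have "VF D (min \<delta> \<delta>') (min t t') \<subseteq> U \<inter> U'"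
  proof
    fix A assume "A \<in> VF D (min \<delta> \<delta>') (min t t')"
    then have A: "A \<in> LF" "level D (rep A) (min t t') < ennreal (min \<delta> \<delta>')" using VF_iff[OF D(1)] by auto
    have "level E (rep A) t \<le> level D (rep A) (min t t')" "level E' (rep A) t' \<le> level D (rep A) (min t t')"
      using level_mono[OF LF_L[OF A(1)] F_sets[OF D(1)]] D by auto
    moreover have "ennreal (min \<delta> \<delta>') \<le> ennreal \<delta>" "ennreal (min \<delta> \<delta>') \<le> ennreal \<delta>'"
      by (auto intro: ennreal_leI)
    ultimately have "level E (rep A) t < ennreal \<delta>" "level E' (rep A) t' < ennreal \<delta>'"
      using A(2) by (meson le_less_trans less_le_trans)+
    then show "A \<in> U \<inter> U'" using U VF_iff A(1) by simp
  qed
  then show "\<exists>W\<in>base. W \<subseteq> U \<inter> U'"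
    using baseI[OF D(1), of "min \<delta> \<delta>'" "min t t'"] U by (intro bexI) auto
next
  fix U assume "U \<in> base"
  then obtain E \<delta> t where U: "U = VF E \<delta> t" "E \<in> F" "0 < \<delta>" "0 < t" unfolding base_def by blast
  \<comment> \<open>Thresholds are divided by \<open>2 * qconst\<close> for the quasi-triangle
    inequality, measures by 2 for subadditivity.\<close>
  define u where "u = t / (2 * qconst)"
  have u: "u > 0" "qconst * (u + u) = t" using U qconst_pos by (simp_all add: u_def)
  have "A \<oplus> B \<in> U" if "A \<in> VF E (\<delta>/2) u" "B \<in> VF E (\<delta>/2) u" for A B
  proof -
    have AB: "A \<in> LF" "level E (rep A) u < ennreal (\<delta>/2)" "B \<in> LF" "level E (rep B) u < ennreal (\<delta>/2)"
      using that VF_iff[OF U(2)] by auto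
    have "level E (rep (A \<oplus> B)) (qconst * (u + u)) \<le> level E (rep A) u + level E (rep B) u"
      using AB LF_L F_sets[OF U(2)] by (intro level_add rep_in(2) L_add_in(2)) auto
    also have "\<dots> < ennreal (\<delta>/2) + ennreal (\<delta>/2)" using AB by (intro add_strict_mono)
    also have "\<dots> = ennreal \<delta>" using U(3) by (simp flip: ennreal_plus)
    finally show ?thesis using U VF_iff LF_add AB u by simp
  qed
  then show "\<exists>W\<in>base. \<forall>x\<in>W. \<forall>y\<in>W. x \<oplus> y \<in> U"
    using baseI[OF U(2), of "\<delta>/2" u] U(3) u(1) by (intro bexI) auto
next
  fix U and c :: real assume "U \<in> base"
  then obtain E \<delta> t where U: "U = VF E \<delta> t" "E \<in> F" "0 < \<delta>" "0 < t" unfolding base_def by blast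
  \<comment> \<open>The real c may be 0 or negative; \<open>\<bar>c\<bar> + 1\<close> is positive
    and dominates every \<open>norm a \<le> c\<close>.\<close>
  define u where "u = t / (\<bar>c\<bar> + 1)"
  have u: "u > 0" "(\<bar>c\<bar> + 1) * u = t" using U by (auto simp: u_def add_nonneg_eq_0_iff add_nonneg_pos)
  have "a \<odot> A \<in> U" if "A \<in> VF E \<delta> u" "norm a \<le> c" for A a
  proof -
    have A: "A \<in> LF" "level E (rep A) u < ennreal \<delta>" using that VF_iff[OF U(2)] by auto
    have "norm a * u \<le> (\<bar>c\<bar> + 1) * u" using that(2) u(1) by (intro mult_right_mono) auto
    then have "level E (rep (a \<odot> A)) t \<le> level E (rep A) u"
      using rep_in(2)[OF LF_L[OF A(1)]] F_sets[OF U(2)] L_scale_in(2)[OF LF_L[OF A(1)]] u(2) U(4)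
      by (intro level_scale) auto
    then show ?thesis using U VF_iff A LF_scale by (simp add: le_less_trans)
  qed
  then show "\<exists>W\<in>base. \<forall>x\<in>W. \<forall>a. norm a \<le> c \<longrightarrow> a \<odot> x \<in> U"
    using baseI[OF U(2,3) u(1)] by (intro bexI) auto
next
  fix U A assume "U \<in> base" and A: "A \<in> LF"
  then obtain E \<delta> t where U: "U = VF E \<delta> t" "E \<in> F" "0 < \<delta>" "0 < t" unfolding base_def by blast
  obtain s0 where "level E (rep A) s0 < \<infinity>" using A U(2) LF_iff by blast
  \<comment> \<open>Finite measure of one level set is upgraded to measure below \<delta> by raising
    the threshold. A scalar of norm below t / s then carries the threshold s to at most t.\<close>
  then obtain s where s: "s > 0" "level E (rep A) s < ennreal \<delta>"
    using level_small[OF rep_in(2)[OF LF_L[OF A]] F_sets[OF U(2)] _ U(3)] by blast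
  have "a \<odot> A \<in> U" if "norm a < t / s" for a
  proof -
    have "norm a * s \<le> t" using that s(1) by (simp add: pos_less_divide_eq)
    then have "level E (rep (a \<odot> A)) t \<le> level E (rep A) s"
      using rep_in(2)[OF LF_L[OF A(1)]] F_sets[OF U(2)] L_scale_in(2)[OF LF_L[OF A(1)]] U(4)
      by (intro level_scale) auto
    then show ?thesis using U VF_iff s A LF_scale by (simp add: le_less_trans)
  qed
  then show "\<exists>e>0. \<forall>a. norm a < e \<longrightarrow> a \<odot> A \<in> U"
    using s(1) U(4) by (intro exI[of _ "t / s"]) auto
next
  fix A assume A: "A \<in> LF" "A \<noteq> \<zero>"
  then obtain E \<delta> t where E: "E \<in> F" "0 < \<delta>" "0 < t" "\<not> level E (rep A) t < ennreal \<delta>"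
    using L_zeroI[OF LF_L[OF A(1)]] by blast
  then have "A \<notin> VF E \<delta> t" using VF_iff by blast
  then show "\<exists>U\<in>base. A \<notin> U" using baseI[OF E(1-3)] by blast
qed

end

section \<open>Completeness\<close>

context continuous_quasi_norm
begin

definition ratio :: real where "ratio = 1 / (2 * qconst)"

lemma ratio: "0 < ratio" "ratio < 1" "2 * qconst * ratio = 1"
  using qconst_ge_1 by (auto simp: ratio_def)

text \<open>The first increment is split off. By the choice of \<open>ratio\<close> the bound for
  the rest, \<open>2 * qconst * ratio ^ (n + 1)\<close>, equals \<open>ratio ^ n\<close>, just as
  large as the first increment; one quasi-triangle inequality returns
  \<open>2 * qconst * ratio ^ n\<close>. So the bound does not grow with p.\<close>

lemma qn_telescope:
  assumes "\<And>j. j \<ge> n \<Longrightarrow> qn (s (Suc j) - s j) \<le> ratio ^ j"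
  shows "qn (s (n + p) - s n) \<le> 2 * qconst * ratio ^ n"
  using assms
proof (induction p arbitrary: n)
  case 0
  then show ?case using qconst_pos ratio(1) by simp
next
  case (Suc p)
  have "qn (s (Suc n + p) - s (Suc n)) \<le> 2 * qconst * ratio ^ Suc n"
    by (rule Suc.IH) (use Suc.prems in simp)
  also have "\<dots> = ratio ^ n" using ratio(3) by (simp add: mult.assoc[symmetric])
  finally have "qn (s (n + Suc p) - s n) \<le> qconst * (ratio ^ n + ratio ^ n)"
    using Suc.prems[of n] by (intro qn_diff_le_mono[of _ "s (Suc n)"]) auto
  then show ?case by simp
qed

text \<open>A late term within \<open>ratio ^ n\<close> of the limit is inserted, at the price of
  one more quasi-triangle inequality. This is the origin of
  \<open>qconst * (2 * qconst + 1)\<close>.\<close>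

lemma qn_telescope_limit:
  assumes "\<And>j. j \<ge> n \<Longrightarrow> qn (s (Suc j) - s j) \<le> ratio ^ j" and lim: "(\<lambda>j. qn (s j - l)) \<longlonglongrightarrow> 0"
  shows "qn (s n - l) \<le> qconst * (2 * qconst + 1) * ratio ^ n"
proof -
  have "eventually (\<lambda>j. qn (s j - l) < ratio ^ n) sequentially"
    using lim ratio(1) by (intro order_tendstoD) auto
  then obtain N where N: "\<And>j. j \<ge> N \<Longrightarrow> qn (s j - l) < ratio ^ n"
    unfolding eventually_sequentially by blast
  have "qn (s n - s (n + N)) \<le> 2 * qconst * ratio ^ n"
    using qn_telescope[of n s N] assms(1) qn_minus_commute[of "s n"] by simp
  then have "qn (s n - l) \<le> qconst * (2 * qconst * ratio ^ n + ratio ^ n)"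
    using N[of "n + N"] by (intro qn_diff_le_mono[of _ "s (n + N)"]) auto
  then show ?thesis by (simp add: algebra_simps)
qed

end

context directed_measurable_classes
begin

text \<open>The sequence is a Cauchy net over the natural numbers, so completeness of the space
  applies through \<open>complete_tvs_net\<close>.\<close>

lemma qn_convergent:
  assumes s: "\<And>j. j \<ge> n \<Longrightarrow> qn (s (Suc j) - s j) \<le> ratio ^ j"
  shows "\<exists>l. (\<lambda>j. qn (s j - l)) \<longlonglongrightarrow> 0"
proof -
  \<comment> \<open>The constant arises from joining two telescoped distances to \<open>s N\<close>;
    N is taken beyond n because the increments are controlled only from there.\<close>
  have small: "\<exists>N\<ge>n. qconst * (2 * qconst + 2 * qconst) * ratio ^ N < e" if e: "e > 0" for e
  proof -
    have "(\<lambda>N. qconst * (2 * qconst + 2 * qconst) * ratio ^ N) \<longlonglongrightarrow> qconst * (2 * qconst + 2 * qconst) * 0"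
      using ratio by (intro tendsto_mult_left LIMSEQ_realpow_zero) auto
    then have "eventually (\<lambda>N. qconst * (2 * qconst + 2 * qconst) * ratio ^ N < e) sequentially"
      using e by (intro order_tendstoD) auto
    then obtain N where N: "\<And>k. k \<ge> N \<Longrightarrow> qconst * (2 * qconst + 2 * qconst) * ratio ^ k < e"
      unfolding eventually_sequentially by blast
    show ?thesis using N[of "max N n"] by (intro exI[of _ "max N n"]) simp
  qed
  have "cauchy_net (+) 0 smul (qn_topology qn) (UNIV :: nat set) (\<le>) s"
    unfolding cauchy_net_def
  proof (intro allI impI)
    fix U assume "nbhd_of (qn_topology qn) 0 U"
    then obtain W where "openin (qn_topology qn) W" "0 \<in> W" "W \<subseteq> U" unfolding nbhd_of_def by blast
    then obtain e where e: "e > 0" "\<And>y. qn (y - 0) \<le> e \<Longrightarrow> y \<in> U"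
      unfolding openin_qn_topology by blast
    obtain N where N: "N \<ge> n" "qconst * (2 * qconst + 2 * qconst) * ratio ^ N < e"
      using small[OF e(1)] by blast
    have "s i + smul (- 1) (s j) \<in> U" if "N \<le> i" "N \<le> j" for i j
    proof -
      have t: "qn (s k - s N) \<le> 2 * qconst * ratio ^ N" if "N \<le> k" for k
        using qn_telescope[of N s "k - N"] s N(1) that by simp
      have "qn (s i - s j) \<le> qconst * (2 * qconst * ratio ^ N + 2 * qconst * ratio ^ N)"
        using t[OF that(1)] t[OF that(2)] qn_minus_commute[of "s N" "s j"]
        by (intro qn_diff_le_mono[of _ "s N"]) auto
      then have "qn (s i - s j) \<le> e" using N(2) by (simp add: algebra_simps)
      then show ?thesis using e(2)[of "s i - s j"] by simp
    qed
    then show "\<exists>i0\<in>UNIV. \<forall>i\<in>UNIV. \<forall>j\<in>UNIV. i0 \<le> i \<longrightarrow> i0 \<le> j \<longrightarrow> s i + smul (- 1) (s j) \<in> U"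
      by blast
  qed
  moreover have "directed_set (UNIV :: nat set) (\<le>)"
    unfolding directed_set_def by (auto, use nat_le_linear in blast)
  ultimately obtain l where l: "net_converges (qn_topology qn) (UNIV :: nat set) (\<le>) s l"
    using complete_tvs_net[OF complete] by fastforce
  have "(\<lambda>j. qn (s j - l)) \<longlonglongrightarrow> 0"
  proof (rule LIMSEQ_I)
    fix r :: real assume "r > 0"
    then have "nbhd_of (qn_topology qn) l {x. qn (x - l) < r}"
      unfolding nbhd_of_def by (intro conjI exI[of _ "{x. qn (x - l) < r}"]) (simp_all add: openin_qn_ball)
    then obtain N where "\<And>j. j \<ge> N \<Longrightarrow> s j \<in> {x. qn (x - l) < r}"
      using l unfolding net_converges_def by blast
    then show "\<exists>N. \<forall>j\<ge>N. norm (qn (s j - l) - 0) < r" using qn_nonneg by auto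
  qed
  then show ?thesis ..
qed

text \<open>A Borel-Cantelli argument. The set where some increment from n on is too large has
  measure at most 2 (1/2)^n within \<open>D m\<close>, and off it the increments telescope, giving
  both convergence and the rate. The restriction \<open>m \<le> n\<close> ensures
  \<open>D m \<subseteq> D j\<close> for all j \<ge> n, since the j-th increment is controlled only
  on \<open>D j\<close>.\<close>

lemma rapidly_cauchy_limit:
  fixes y :: "nat \<Rightarrow> ('a \<Rightarrow> 'x) set"
  assumes y: "\<And>n. y n \<in> L" and D: "\<And>n::nat. D n \<in> sets M" "incseq D"
    and cover: "AE \<omega> in M. \<omega> \<in> (\<Union>n. D n)"
    and small: "\<And>n. level (D n) (rep (minus_L (y (Suc n)) (y n))) (ratio ^ n) \<le> ennreal ((1/2) ^ n)"
  shows "\<exists>l\<in>L. \<forall>m n. m \<le> n \<longrightarrow>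
    level (D m) (rep (minus_L (y n) l)) (qconst * (2 * qconst + 1) * ratio ^ n) \<le> ennreal (2 * (1/2) ^ n)"
proof -
  define e where "e n = rep (minus_L (y (Suc n)) (y n))" for n
  define S where "S n = superlevel M qn (e n) (ratio ^ n)" for n
  define T where "T m n = (\<Union>j. D m \<inter> S (n + j))" for m n
  have eSM: "e n \<in> SM" for n unfolding e_def by (intro rep_in(2) minus_L_in(1) y)
  have S: "S n \<in> sets M" for n unfolding S_def using superlevel_sets[OF eSM] .
  have T: "T m n \<in> sets M" for m n unfolding T_def using D(1) S by blast
  have T_le: "emeasure M (T m n) \<le> ennreal (2 * (1/2) ^ n)" if "m \<le> n" for m n
  proof -
    have "emeasure M (D m \<inter> S (n + j)) \<le> ennreal ((1/2) ^ n * (1/2) ^ j)" for j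
    proof -
      have "D m \<subseteq> D (n + j)" using D(2) that by (simp add: incseq_def)
      then have "emeasure M (D m \<inter> S (n + j)) \<le> emeasure M (D (n + j) \<inter> S (n + j))"
        using D(1) S by (intro emeasure_mono) auto
      also have "\<dots> \<le> ennreal ((1/2) ^ (n + j))"
        using small[of "n + j"] by (simp add: level_def S_def e_def)
      finally show ?thesis by (simp add: power_add)
    qed
    moreover have "emeasure M (T m n) \<le> (\<Sum>j. emeasure M (D m \<inter> S (n + j)))"
      unfolding T_def using D(1) S by (intro emeasure_subadditive_countably) auto
    ultimately have "emeasure M (T m n) \<le> (\<Sum>j. ennreal ((1/2) ^ n * (1/2) ^ j))"
      by (meson order_trans suminf_le summableI)
    also have "\<dots> = ennreal ((1/2) ^ n * (1 / (1 - 1/2)))"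
      by (intro suminf_ennreal_eq sums_mult geometric_sums) auto
    finally show ?thesis by (simp add: mult.commute)
  qed
  \<comment> \<open>The intersection lies in every \<open>T m n\<close> with n \<ge> m, and the
    measures of these tend to 0.\<close>
  have "(\<Inter>n. T m n) \<in> null_sets M" for m
  proof (rule null_setsI)
    have "emeasure M (\<Inter>n. T m n) \<le> ennreal (2 * (1/2) ^ n)" if "m \<le> n" for n
    proof -
      have "emeasure M (\<Inter>n. T m n) \<le> emeasure M (T m n)" using T by (intro emeasure_mono) auto
      then show ?thesis using T_le[OF that] by (rule order_trans)
    qed
    moreover have "(\<lambda>n. ennreal (2 * (1/2) ^ n)) \<longlonglongrightarrow> ennreal (2 * 0)"
      by (intro tendsto_ennrealI tendsto_mult_left LIMSEQ_realpow_zero) auto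
    ultimately have "emeasure M (\<Inter>n. T m n) \<le> ennreal (2 * 0)"
      by (intro LIMSEQ_le_const[of _ "ennreal (2 * 0)"]) auto
    then show "emeasure M (\<Inter>n. T m n) = 0" by simp
  qed (use T in blast)
  then have null: "AE \<omega> in M. \<forall>m. \<omega> \<notin> (\<Inter>n. T m n)"
    unfolding AE_all_countable using AE_not_in by blast
  have diff: "AE \<omega> in M. \<forall>n. e n \<omega> = rep (y (Suc n)) \<omega> - rep (y n) \<omega>"
    unfolding AE_all_countable e_def using minus_L_in(2) y by blast
  have step: "qn (rep (y (Suc j)) \<omega> - rep (y j) \<omega>) \<le> ratio ^ j"
    if "\<omega> \<in> space M" "\<forall>n. e n \<omega> = rep (y (Suc n)) \<omega> - rep (y n) \<omega>" "\<omega> \<in> D m" "\<omega> \<notin> T m n" "n \<le> j"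
    for \<omega> m n j
  proof -
    have "\<omega> \<notin> S (n + (j - n))" using that unfolding T_def by blast
    then show ?thesis using that by (simp add: S_def superlevel_def)
  qed
  have "AE \<omega> in M. \<exists>l. (\<lambda>n. qn (rep (y n) \<omega> - l)) \<longlonglongrightarrow> 0"
    using null diff cover AE_space
  proof eventually_elim
    case (elim \<omega>)
    then obtain m where m: "\<omega> \<in> D m" by auto
    obtain n where n: "\<omega> \<notin> T m n" using elim(1) by auto
    show ?case by (rule qn_convergent[of n]) (rule step[OF elim(4,2) m n])
  qed
  then obtain h where h: "h \<in> SM" "AE \<omega> in M. (\<lambda>n. qn (rep (y n) \<omega> - h \<omega>)) \<longlonglongrightarrow> 0"
    using strongly_measurable_limit[of "\<lambda>n. rep (y n)"] rep_in(2)[OF y] by blast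
  define l where "l = cls h"
  have l: "l \<in> L" "AE \<omega> in M. rep l \<omega> = h \<omega>"
    unfolding l_def using cls_in_L[OF h(1)] rep_cls[OF h(1)] by auto
  have "level (D m) (rep (minus_L (y n) l)) (qconst * (2 * qconst + 1) * ratio ^ n) \<le> ennreal (2 * (1/2) ^ n)"
    if "m \<le> n" for m n
  proof -
    have "level (D m) (rep (minus_L (y n) l)) (qconst * (2 * qconst + 1) * ratio ^ n) \<le> emeasure M (T m n)"
      unfolding level_def
    proof (rule emeasure_mono_AE)
      show "AE \<omega> in M. \<omega> \<in> D m \<inter> superlevel M qn (rep (minus_L (y n) l)) (qconst * (2 * qconst + 1) * ratio ^ n)
          \<longrightarrow> \<omega> \<in> T m n"
        using diff h(2) l(2) minus_L_in(2)[OF y l(1), of n] AE_space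
      proof eventually_elim
        case (elim \<omega>)
        have "qn (rep (y n) \<omega> - h \<omega>) \<le> qconst * (2 * qconst + 1) * ratio ^ n"
          if "\<omega> \<in> D m" "\<omega> \<notin> T m n"
          by (rule qn_telescope_limit[of n "\<lambda>n. rep (y n) \<omega>"])
            (use step[OF elim(5,1) that] elim(2) in auto)
        then show ?case using elim by (auto simp: superlevel_def not_less[symmetric])
      qed
    qed (rule T)
    then show ?thesis using T_le[OF that] by (rule order_trans)
  qed
  then show ?thesis using l(1) by blast
qed

text \<open>The family need not contain a countable cofinal subfamily, so the limit of a suitable sequence
  from the net is compared with the net itself on the members \<open>D m\<close> of a countable cover first;
  the estimate obtained there does not depend on \<open>m\<close>.\<close>

lemma LF_complete:
  assumes I: "directed_set I le" and x: "\<And>i. i \<in> I \<Longrightarrow> x i \<in> LF"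
    and cauchy: "\<And>E \<delta> t. E \<in> F \<Longrightarrow> 0 < \<delta> \<Longrightarrow> 0 < t \<Longrightarrow>
      \<exists>k\<in>I. \<forall>i\<in>I. \<forall>j\<in>I. le k i \<longrightarrow> le k j \<longrightarrow> level E (rep (minus_L (x i) (x j))) t < ennreal \<delta>"
  shows "\<exists>l\<in>LF. \<forall>E\<in>F. \<forall>\<delta>>0. \<forall>t>0. \<exists>k\<in>I. \<forall>i\<in>I. le k i \<longrightarrow> level E (rep (minus_L (x i) l)) t < ennreal \<delta>"
proof -
  note dir = I[unfolded directed_set_def, THEN conjunct2, THEN conjunct1]
    I[unfolded directed_set_def, THEN conjunct2, THEN conjunct2, THEN conjunct1]
    I[unfolded directed_set_def, THEN conjunct2, THEN conjunct2, THEN conjunct2]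
  have refl: "le i i" if "i \<in> I" for i
    using bspec[OF dir(1) that] .
  have trans: "le i k" if "i \<in> I" "j \<in> I" "k \<in> I" "le i j" "le j k" for i j k
    using dir(2) that by meson
  have upper: "\<exists>k\<in>I. le i k \<and> le j k" if "i \<in> I" "j \<in> I" for i j
    using bspec[OF bspec[OF dir(3) that(1)] that(2)] .
  have xL: "x i \<in> L" if "i \<in> I" for i using x[OF that] LF_L by simp
  obtain D :: "nat \<Rightarrow> 'a set" where D: "\<And>n. D n \<in> F" "incseq D" "AE \<omega> in M. \<omega> \<in> (\<Union>n. D n)"
    using exhausting_sequence by blast
  have Ds: "D n \<in> sets M" for n using F_sets[OF D(1)] .
  \<comment> \<open>The rates are those of \<open>rapidly_cauchy_limit\<close>. The property is
    inherited by every later index, so the indices can be chosen increasing.\<close>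
  define good where "good n k \<longleftrightarrow> k \<in> I \<and> (\<forall>i\<in>I. \<forall>j\<in>I. le k i \<longrightarrow> le k j \<longrightarrow>
    level (D n) (rep (minus_L (x i) (x j))) (ratio ^ n) < ennreal ((1/2) ^ n))" for n k
  have good: "\<exists>k. good n k" for n
    using cauchy[OF D(1), of "(1/2) ^ n" "ratio ^ n" n] ratio(1) unfolding good_def by auto
  have "\<exists>k. \<forall>n. good n (k n) \<and> le (k n) (k (Suc n))"
  proof (rule dependent_nat_choice)
    fix k n assume k: "good n k"
    obtain k' where k': "good (Suc n) k'" using good by blast
    obtain j where j: "j \<in> I" "le k j" "le k' j" using upper k k' unfolding good_def by blast
    have "good (Suc n) j"
      unfolding good_def
    proof (intro conjI ballI impI)
      fix i i' assume "i \<in> I" "i' \<in> I" "le j i" "le j i'"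
      moreover have "k' \<in> I" using k' good_def by blast
      ultimately have "le k' i" "le k' i'" using trans[OF _ j(1) _ j(3)] by blast+
      then show "level (D (Suc n)) (rep (minus_L (x i) (x i'))) (ratio ^ Suc n) < ennreal ((1/2) ^ Suc n)"
        using k' \<open>i \<in> I\<close> \<open>i' \<in> I\<close> unfolding good_def by blast
    qed (rule j)
    then show "\<exists>j. good (Suc n) j \<and> le k j" using j(2) by blast
  qed (rule good)
  then obtain k where k: "\<And>n. good n (k n)" "\<And>n. le (k n) (k (Suc n))" by blast
  have kI: "k n \<in> I" for n using k(1) good_def by blast
  have k_level: "level (D n) (rep (minus_L (x i) (x j))) (ratio ^ n) < ennreal ((1/2) ^ n)"
    if "i \<in> I" "j \<in> I" "le (k n) i" "le (k n) j" for n i j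
    using k(1)[of n] that unfolding good_def by blast
  have "\<exists>l\<in>L. \<forall>m n. m \<le> n \<longrightarrow> level (D m) (rep (minus_L (x (k n)) l))
      (qconst * (2 * qconst + 1) * ratio ^ n) \<le> ennreal (2 * (1/2) ^ n)"
    by (rule rapidly_cauchy_limit)
      (use xL[OF kI] Ds D(2,3) k_level[OF kI kI k(2) refl[OF kI]] in \<open>auto intro: less_imp_le\<close>)
  then obtain l where l: "l \<in> L" and l_level: "\<And>m n. m \<le> n \<Longrightarrow> level (D m) (rep (minus_L (x (k n)) l))
      (qconst * (2 * qconst + 1) * ratio ^ n) \<le> ennreal (2 * (1/2) ^ n)"
    by blast
  \<comment> \<open>Carries a bound for the differences to all late net terms over to the limit: the
    threshold grows from t to \<open>qconst * (t + t)\<close>, the bound on the measure stays the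
    same.\<close>
  have key: "level E (rep (minus_L (x i) l)) (qconst * (t + t)) \<le> ennreal \<delta>"
    if E: "E \<in> F" and i: "i \<in> I" "i0 \<in> I" "le i0 i" and t: "0 < t"
      and i0: "\<And>j. j \<in> I \<Longrightarrow> le i0 j \<Longrightarrow> level E (rep (minus_L (x i) (x j))) t \<le> ennreal \<delta>"
    for E i i0 t \<delta>
  proof (rule level_le_exhaustion[OF minus_L_in(1)[OF xL[OF i(1)] l] F_sets[OF E] Ds D(2,3)])
    fix m
    have EDm: "E \<inter> D m \<in> sets M" using F_sets[OF E] Ds by blast
    \<comment> \<open>The threshold for x j - l obtained by passing through the sequence term x (k
      n); it tends to 0 and so drops below t.\<close>
    define c where "c n = qconst * (ratio ^ n + qconst * (2 * qconst + 1) * ratio ^ n)" for n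
    have "(\<lambda>n. qconst * (ratio ^ n + qconst * (2 * qconst + 1) * ratio ^ n)) \<longlonglongrightarrow>
        qconst * (0 + qconst * (2 * qconst + 1) * 0)"
      using ratio by (intro tendsto_mult_left tendsto_add LIMSEQ_realpow_zero) auto
    then have "eventually (\<lambda>n. c n < t) sequentially"
      using t by (intro order_tendstoD[where y = "0::real"]) (simp_all add: c_def)
    then obtain N where N: "\<And>n. n \<ge> N \<Longrightarrow> c n < t" unfolding eventually_sequentially by blast
    have "level (E \<inter> D m) (rep (minus_L (x i) l)) (qconst * (t + t))
        \<le> ennreal \<delta> + ennreal (3 * (1/2) ^ n)" if n: "max m N \<le> n" for n
    proof -
      \<comment> \<open>The auxiliary index is late enough for the Cauchy bound on \<open>E\<close>
        and also for the sequence bound on \<open>D n\<close>. It depends on n, but no trace of it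
        remains in the final estimate.\<close>
      obtain j where j: "j \<in> I" "le i0 j" "le (k n) j" using upper[OF i(2) kI] by blast
      have L: "minus_L (x i) (x j) \<in> L" "minus_L (x j) l \<in> L"
        "minus_L (x j) (x (k n)) \<in> L" "minus_L (x (k n)) l \<in> L"
        using minus_L_in(1) xL i j kI l by auto
      have "level (E \<inter> D m) (rep (minus_L (x i) l)) (qconst * (t + t))
          \<le> level (E \<inter> D m) (rep (minus_L (x i) (x j))) t + level (E \<inter> D m) (rep (minus_L (x j) l)) t"
        by (rule level_minus_triangle[OF xL[OF i(1)] xL[OF j(1)] l EDm])
      also have "level (E \<inter> D m) (rep (minus_L (x i) (x j))) t \<le> level E (rep (minus_L (x i) (x j))) t"
        using F_sets[OF E] by (intro level_mono L) auto
      also have "\<dots> \<le> ennreal \<delta>" by (rule i0[OF j(1,2)])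
      also have "level (E \<inter> D m) (rep (minus_L (x j) l)) t \<le> level (D m) (rep (minus_L (x j) l)) (c n)"
        using Ds N[of n] n by (intro level_mono L) auto
      also have "\<dots> \<le> level (D m) (rep (minus_L (x j) (x (k n)))) (ratio ^ n)
          + level (D m) (rep (minus_L (x (k n)) l)) (qconst * (2 * qconst + 1) * ratio ^ n)"
        unfolding c_def by (rule level_minus_triangle[OF xL[OF j(1)] xL[OF kI] l Ds])
      also have "level (D m) (rep (minus_L (x j) (x (k n)))) (ratio ^ n)
          \<le> level (D n) (rep (minus_L (x j) (x (k n)))) (ratio ^ n)"
        using Ds D(2) n by (intro level_mono L) (auto simp: incseq_def)
      also have "\<dots> \<le> ennreal ((1/2) ^ n)"
        using k_level[OF j(1) kI j(3) refl[OF kI]] by (rule less_imp_le)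
      also have "level (D m) (rep (minus_L (x (k n)) l)) (qconst * (2 * qconst + 1) * ratio ^ n)
          \<le> ennreal (2 * (1/2) ^ n)"
        using l_level n by simp
      also have "ennreal ((1/2) ^ n) + ennreal (2 * (1/2) ^ n) = ennreal (3 * (1/2) ^ n)"
        by (simp flip: ennreal_plus)
      finally show ?thesis by (simp add: add_left_mono add_right_mono)
    qed
    \<comment> \<open>Here m is fixed and n tends to infinity; the passage from
      \<open>E \<inter> D m\<close> to \<open>E\<close> is left to
      \<open>level_le_exhaustion\<close>.\<close>
    moreover have "(\<lambda>n. ennreal \<delta> + ennreal (3 * (1/2) ^ n)) \<longlonglongrightarrow> ennreal \<delta> + ennreal (3 * 0)"
      by (intro tendsto_add tendsto_const tendsto_ennrealI tendsto_mult_left LIMSEQ_realpow_zero) auto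
    ultimately have "level (E \<inter> D m) (rep (minus_L (x i) l)) (qconst * (t + t)) \<le> ennreal \<delta> + ennreal (3 * 0)"
      by (intro LIMSEQ_le_const[of _ "ennreal \<delta> + ennreal (3 * 0)"]) blast+
    then show "level (E \<inter> D m) (rep (minus_L (x i) l)) (qconst * (t + t)) \<le> ennreal \<delta>" by simp
  qed
  have conv: "\<exists>i0\<in>I. \<forall>i\<in>I. le i0 i \<longrightarrow> level E (rep (minus_L (x i) l)) t < ennreal \<delta>"
    if E: "E \<in> F" and pos: "0 < \<delta>" "0 < t" for E \<delta> t
  proof -
    define u where "u = t / (2 * qconst)"
    have u: "u > 0" "qconst * (u + u) = t" using pos qconst_pos by (simp_all add: u_def)
    \<comment> \<open>Only a non-strict bound survives the limits in \<open>key\<close>; starting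
      from \<delta>/2 restores the strict inequality.\<close>
    obtain i0 where i0: "i0 \<in> I" "\<And>i j. i \<in> I \<Longrightarrow> j \<in> I \<Longrightarrow> le i0 i \<Longrightarrow> le i0 j \<Longrightarrow>
        level E (rep (minus_L (x i) (x j))) u < ennreal (\<delta>/2)"
      using cauchy[OF E half_gt_zero[OF pos(1)] u(1)] by blast
    have "level E (rep (minus_L (x i) l)) t < ennreal \<delta>" if "i \<in> I" "le i0 i" for i
    proof -
      have "level E (rep (minus_L (x i) l)) (qconst * (u + u)) \<le> ennreal (\<delta>/2)"
        using i0(2)[OF that(1) _ that(2)] by (intro key[OF E that(1) i0(1) that(2) u(1)] less_imp_le)
      also have "ennreal (\<delta>/2) < ennreal \<delta>" using pos(1) by (intro ennreal_lessI) auto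
      finally show ?thesis unfolding u(2) .
    qed
    then show ?thesis using i0(1) by blast
  qed
  have "l \<in> LF"
    unfolding LF_iff
  proof (intro conjI ballI)
    fix E assume E: "E \<in> F"
    \<comment> \<open>Membership of the limit follows from l = (l - x i) + x i for one late i, since
      both summands have a level set of finite measure on \<open>E\<close>.\<close>
    obtain i where i: "i \<in> I" "level E (rep (minus_L (x i) l)) 1 < ennreal 1"
      using conv[OF E, of 1 1] refl by auto
    obtain s where s: "s > 0" "level E (rep (x i)) s < \<infinity>" using x[OF i(1)] E LF_iff by blast
    have m: "minus_L l (x i) \<in> L" using minus_L_in(1)[OF l xL[OF i(1)]] .
    have "AE \<omega> in M. qn (rep (minus_L l (x i)) \<omega>) = qn (rep (minus_L (x i) l) \<omega>)"
      using minus_L_in(2)[OF l xL[OF i(1)]] minus_L_in(2)[OF xL[OF i(1)] l]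
      by eventually_elim (simp add: qn_minus_commute[of "rep l _"])
    then have "AE \<omega> in M. \<omega> \<in> E \<longrightarrow> 1 < qn (rep (minus_L l (x i)) \<omega>)
        \<longrightarrow> \<omega> \<in> E \<and> 1 < qn (rep (minus_L (x i) l) \<omega>)"
      by eventually_elim simp
    then have "level E (rep (minus_L l (x i))) 1 \<le> level E (rep (minus_L (x i) l)) 1"
      by (rule level_le[OF rep_in(2)[OF minus_L_in(1)[OF xL[OF i(1)] l]] F_sets[OF E]])
    also have "\<dots> < \<infinity>" using i(2) by (rule less_trans) simp
    finally have fin: "level E (rep (minus_L l (x i))) 1 < \<infinity>" .
    have "AE \<omega> in M. rep l \<omega> = rep (minus_L l (x i)) \<omega> + rep (x i) \<omega>"
      using minus_L_in(2)[OF l xL[OF i(1)]] by eventually_elim simp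
    then show "\<exists>t>0. level E (rep l) t < \<infinity>"
      by (rule level_finite_add[OF m xL[OF i(1)] l _ F_sets[OF E] zero_less_one fin s])
  qed (rule l)
  then show ?thesis using conv by blast
qed

lemma topology_exists:
  "\<exists>T. topological_vector_space_on LF (L_add M smul qn) \<zero> (L_scale M smul qn) T
     \<and> nbhd_basis_at T \<zero> base
     \<and> complete_tvs (L_add M smul qn) \<zero> (L_scale M smul qn) T"
proof -
  interpret N: tvs_neighbourhood_base LF "L_add M smul qn" \<zero> "L_scale M smul qn" base
    by (rule neighbourhood_base)
  have minus: "N.vdiff = minus_L" by (intro ext) (simp add: N.vdiff_def minus_L_def)
  have "complete_tvs (L_add M smul qn) \<zero> (L_scale M smul qn) N.base_topology"
  proof (rule N.complete_base_topology, unfold minus)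
    fix I :: "(('a \<Rightarrow> 'x) set set \<times> ('a \<Rightarrow> 'x) set) set" and le x
    assume I: "directed_set I le" and x: "x ` I \<subseteq> LF"
      and C: "\<And>U. U \<in> base \<Longrightarrow> \<exists>k\<in>I. \<forall>i\<in>I. \<forall>j\<in>I. le k i \<longrightarrow> le k j \<longrightarrow> minus_L (x i) (x j) \<in> U"
    have xLF: "x i \<in> LF" if "i \<in> I" for i using x that by blast
    have "\<exists>k\<in>I. \<forall>i\<in>I. \<forall>j\<in>I. le k i \<longrightarrow> le k j \<longrightarrow> level E (rep (minus_L (x i) (x j))) t < ennreal \<delta>"
      if "E \<in> F" "0 < \<delta>" "0 < t" for E \<delta> t
      using C[OF baseI[OF that]] VF_iff[OF that(1)] by blast
    then obtain l where l: "l \<in> LF" "\<And>E \<delta> t. E \<in> F \<Longrightarrow> 0 < \<delta> \<Longrightarrow> 0 < t \<Longrightarrow>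
        \<exists>k\<in>I. \<forall>i\<in>I. le k i \<longrightarrow> level E (rep (minus_L (x i) l)) t < ennreal \<delta>"
      using LF_complete[of I le x, OF I xLF] by blast
    have "\<exists>k\<in>I. \<forall>i\<in>I. le k i \<longrightarrow> minus_L (x i) l \<in> U" if "U \<in> base" for U
    proof -
      obtain E \<delta> t where U: "U = VF E \<delta> t" "E \<in> F" "0 < \<delta>" "0 < t"
        using \<open>U \<in> base\<close> unfolding base_def by blast
      show ?thesis using l(2)[OF U(2-4)] U(1) VF_iff[OF U(2)] LF_minus[OF xLF l(1)] by blast
    qed
    then show "\<exists>l\<in>LF. \<forall>U\<in>base. \<exists>k\<in>I. \<forall>i\<in>I. le k i \<longrightarrow> minus_L (x i) l \<in> U" using l(1) by blast
  qed
  then show ?thesis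
    using N.topological_vector_space_base_topology N.nbhd_basis_base_topology by blast
qed

end

theorem mainTheorem2:
  fixes M :: "'a measure"
    and smul :: "'k::real_normed_field \<Rightarrow> 'x::ab_group_add \<Rightarrow> 'x"
    and qn :: "'x \<Rightarrow> real"
    and F :: "'a set set"
  assumes "quasi_banach_space smul qn"
    and "continuous_map (qn_topology qn) euclideanreal qn"
    and "F \<subseteq> sets M"
    and "F \<noteq> {}"
    and "directed_to M F (space M)"
  shows "\<exists>T. topological_vector_space_on (L_family M smul qn F)
               (L_add M smul qn) (L_zero M smul qn) (L_scale M smul qn) T
           \<and> nbhd_basis_at T (L_zero M smul qn)
               {V_set M smul qn E \<delta> t \<inter> L_family M smul qn F | E \<delta> t. E \<in> F \<and> 0 < \<delta> \<and> 0 < t}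
           \<and> complete_tvs (L_add M smul qn) (L_zero M smul qn) (L_scale M smul qn) T"
proof -
  interpret quasi_banach_space smul qn by (rule assms(1))
  interpret directed_measurable_classes smul qn M F
    by unfold_locales (use assms in auto)
  show ?thesis using topology_exists unfolding base_def VF_def .
qed

end
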